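(* Fix an integer $d \geq 3$ and a real number $\lambda < d$. For infinitely many positive integers $n$ (with $n\to\infty$), let $G=G_n$ be an $(n,d,\lambda)$ graph whose girth is larger than $10\log_{d-1}\log n$, and let $(w_0,w_1,\ldots,w_n)$ be a non-backtracking random walk of length $n$ on $G$ (from a starting vertex $w_0\in V(G)$). Then the maximal number of visits to a single vertex made by the walk, $\max_{v\in V(G)}|\{1\le i\le n: w_i=v\}|$, is with high probability $$\left(1+(1+o(1))\frac{\log\log\log n}{\log \log n}\right)\frac{\log n}{\log\log n},$$ where the $o(1)$-term tends to $0$ as $n\to\infty$. That is, there is a deterministic sequence $\epsilon_n\to0$ such that, with probability tending to $1$ as $n\to\infty$, this maximum equals $\left(1+(1+\eta)\frac{\log\log\log n}{\log \log n}\right)\frac{\log n}{\log\log n}$ for some (random) $\eta$ with $|\eta|\le\epsilon_n$.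
   Context: An $(n,d,\lambda)$ graph is a $d$-regular undirected graph on $n$ vertices such that, if $d=\lambda_1\ge\lambda_2\ge\dots\ge\lambda_n$ are the eigenvalues of its adjacency matrix, then $\max_{i>1}|\lambda_i| = \lambda$. The girth is the length of a shortest cycle. A non-backtracking random walk of length $k$ on $G$ starting from a vertex $w_0$ is a random sequence $(w_0,\ldots,w_k)$ of vertices, where $w_1$ is a uniformly chosen neighbor of $w_0$ and, for $i\ge 2$, given $w_0,\ldots,w_{i-1}$, the vertex $w_i$ is chosen uniformly among all neighbors of $w_{i-1}$ other than $w_{i-2}$. All logarithms without an indicated base are natural; $\log_{d-1}$ is the logarithm to base $d-1$. An event, defined for every $n$, occurs with high probability if its probability tends to $1$ as $n\to\infty$. *)

theory Defs
  imports
    "HOL-Probability.Probability"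
    "Graph_Theory.Pair_Digraph"
    "Jordan_Normal_Form.Char_Poly"
begin

text \<open>
  A finite simple undirected graph is a \<open>pair_graph\<close>: a finite symmetric loop-free digraph
  without parallel arcs, each undirected edge being represented by its two orientations.
\<close>

definition neighbors :: "'a pair_pre_digraph \<Rightarrow> 'a \<Rightarrow> 'a set" where
  "neighbors G v = {w. (v, w) \<in> parcs G}"

definition adjacency_matrix :: "'a pair_pre_digraph \<Rightarrow> 'a list \<Rightarrow> real mat" where
  "adjacency_matrix G vs =
     mat (length vs) (length vs) (\<lambda>(i, j). if (vs ! i, vs ! j) \<in> parcs G then 1 else 0)"

text \<open>
  The eigenvalues, listed with multiplicity in non-increasing order (\<open>es ! 0\<close> is the largest one).
\<close>

definition ordered_eigenvalues :: "real mat \<Rightarrow> real list \<Rightarrow> bool" where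
  "ordered_eigenvalues A es \<longleftrightarrow>
     sorted_wrt (\<ge>) es \<and> char_poly A = (\<Prod>e\<leftarrow>es. [:- e, 1:])"

text \<open>
  The enumeration \<open>vs\<close> of the vertices only serves to index the matrix; the spectrum does not
  depend on it. The list \<open>es\<close> is 0-based, so the indices \<open>i > 1\<close> of the usual numbering
  are \<open>{1..<n}\<close> here.
\<close>

definition ndl_graph :: "nat \<Rightarrow> nat \<Rightarrow> real \<Rightarrow> 'a pair_pre_digraph \<Rightarrow> bool" where
  "ndl_graph n d lam G \<longleftrightarrow>
     pair_graph G \<and> card (pverts G) = n \<and>
     (\<forall>v \<in> pverts G. card (neighbors G v) = d) \<and>
     (\<exists>vs es. distinct vs \<and> set vs = pverts G \<and>
        ordered_eigenvalues (adjacency_matrix G vs) es \<and>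
        Max ((\<lambda>i. \<bar>es ! i\<bar>) ` {1..<n}) = lam)"

text \<open>
  A directed cycle of length 2 only traverses one undirected edge back and forth, hence the bound 3.
  The girth of a forest is \<open>\<infinity>\<close>.
\<close>

definition girth :: "'a pair_pre_digraph \<Rightarrow> enat" where
  "girth G = (INF p \<in> {p. pre_digraph.cycle (with_proj G) p \<and> length p \<ge> 3}. enat (length p))"

text \<open>
  \<open>nb_walk G v k\<close> is the law of the list \<open>[w\<^sub>0, \<dots>, w\<^sub>k]\<close> with \<open>w\<^sub>0 = v\<close>.
\<close>

definition nb_step :: "'a pair_pre_digraph \<Rightarrow> 'a list \<Rightarrow> 'a pmf" where
  "nb_step G ws =
     (if length ws \<le> 1 then pmf_of_set (neighbors G (last ws))
      else pmf_of_set (neighbors G (last ws) - {ws ! (length ws - 2)}))"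

primrec nb_walk :: "'a pair_pre_digraph \<Rightarrow> 'a \<Rightarrow> nat \<Rightarrow> 'a list pmf" where
  "nb_walk G v 0 = return_pmf [v]"
| "nb_walk G v (Suc k) = bind_pmf (nb_walk G v k) (\<lambda>ws. map_pmf (\<lambda>w. ws @ [w]) (nb_step G ws))"

definition max_visits :: "'a pair_pre_digraph \<Rightarrow> nat \<Rightarrow> 'a list \<Rightarrow> nat" where
  "max_visits G n ws = Max ((\<lambda>v. card {i. 1 \<le> i \<and> i \<le> n \<and> ws ! i = v}) ` pverts G)"

end

theory Submission
  imports Defs "Jordan_Normal_Form.Schur_Decomposition" "HOL-Real_Asymp.Real_Asymp"
begin

text \<open>
  Spectral part: the law \<open>p\<^sub>k\<close> of a non-backtracking walk satisfies
  \<open>p\<^sub>k\<^sub>+\<^sub>2 = (A p\<^sub>k\<^sub>+\<^sub>1 - p\<^sub>k) / (d - 1)\<close>, so it is a polynomial in the adjacency matrix which decays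
  geometrically on \<open>[-\<lambda>, \<lambda>]\<close>; the trace of its square bounds its distance from uniformity, so the
  walk mixes within \<open>K = O(log n)\<close> steps. The girth makes the expected number of returns to a vertex
  within \<open>K\<close> steps \<open>O((log n)\<^sup>-\<^sup>4)\<close>.

  Upper bound: a renewal inequality yields \<open>E \<theta>\<^sup>X \<le> exp (O(\<theta>))\<close>, up to logarithmic factors, for the number
  \<open>X\<close> of visits to a vertex and \<open>\<theta> = O(log n)\<close>; then take \<open>\<theta>\<close> equal to the threshold in Markov's
  inequality.

  Lower bound: forgetting every other stretch of \<open>K\<close> steps compares the walk with independent
  stationary blocks of length \<open>K\<close>. The number \<open>Z\<close> of vertices lying in at least \<open>t\<close> blocks is
  self-bounding, and Efron-Stein gives \<open>Var Z \<le> K t E Z\<close>, whereas \<open>E Z \<ge> n (8 t)\<^sup>-\<^sup>t / 2\<close>.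
  Factors \<open>C\<^sup>t\<close> are negligible at the precision of the statement.
\<close>

section \<open>Polynomials of the adjacency matrix\<close>

text \<open>The threshold \<open>t\<close> is where \<open>t ln t\<close> balances
  \<open>ln n\<close>. A factor \<open>C^t\<close> shifts it by a relative O(1 / ln ln n), whereas
  the statement resolves relative shifts of order \<open>ln ln ln n / ln ln n\<close>. Constants
  such as the 8 in \<open>(8 t)^t\<close> or in \<open>exp (8 \<theta>)\<close> therefore perturb
  \<eta> only by O(1 / ln ln ln n), and this slack permits crude estimates.

  The girth enters through half its length: two non-backtracking walks of equal length with
  different first steps and a common end contain a cycle of at most twice that length. With
  \<open>r\<close> about \<open>5 log_{d-1} ln n\<close>, hitting probabilities from time
  \<open>r\<close> on are O((ln n)^(-5)), and summing over \<open>K\<close> steps leaves the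
  exponent 4. Multiplied by \<theta> this still vanishes, so clustered returns do not inflate the
  generating function.

  The obstacle in the lower bound is that occurrences of different vertices are dependent, even
  inside one block, so a direct second moment would need the joint laws of all pairs. Efron-Stein
  replaces them by the effect of deleting one block, which the block length controls.\<close>

fun nb_poly :: "real \<Rightarrow> real \<Rightarrow> nat \<Rightarrow> real" where
  "nb_poly d x 0 = 1"
| "nb_poly d x (Suc 0) = x / d"
| "nb_poly d x (Suc (Suc k)) = (x * nb_poly d x (Suc k) - nb_poly d x k) / (d - 1)"

text \<open>For the adjacency matrix of a \<open>d\<close>-regular graph and
  \<open>k \<ge> 1\<close>: the matrix counting non-backtracking walks of length \<open>k\<close>,
  divided by their number \<open>d (d - 1)^(k - 1)\<close> from each vertex.\<close>

fun nb_poly_mat :: "real \<Rightarrow> real mat \<Rightarrow> nat \<Rightarrow> real mat" where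
  "nb_poly_mat d A 0 = 1\<^sub>m (dim_row A)"
| "nb_poly_mat d A (Suc 0) = (1 / d) \<cdot>\<^sub>m A"
| "nb_poly_mat d A (Suc (Suc k)) = (1 / (d - 1)) \<cdot>\<^sub>m (A * nb_poly_mat d A (Suc k) - nb_poly_mat d A k)"

definition mat_trace :: "real mat \<Rightarrow> real" where
  "mat_trace A = (\<Sum>i<dim_row A. A $$ (i, i))"

lemma nb_poly_mat_carrier [simp]:
  "A \<in> carrier_mat n n \<Longrightarrow> nb_poly_mat d A k \<in> carrier_mat n n"
  by (induction d A k rule: nb_poly_mat.induct) auto

lemma mult_mat_index_sum:
  assumes "A \<in> carrier_mat n m" "B \<in> carrier_mat m l" "i < n" "j < l"
  shows "(A * B) $$ (i, j) = (\<Sum>k<m. A $$ (i, k) * B $$ (k, j))"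
  using assms by (auto simp: scalar_prod_def atLeast0LessThan intro!: sum.cong)

lemma mat_trace_comm:
  assumes "A \<in> carrier_mat n n" "B \<in> carrier_mat n n"
  shows "mat_trace (A * B) = mat_trace (B * A)"
proof -
  have "mat_trace (A * B) = (\<Sum>i<n. \<Sum>k<n. A $$ (i, k) * B $$ (k, i))"
    using assms unfolding mat_trace_def by (auto simp: mult_mat_index_sum[OF assms] simp del: index_mult_mat(1))
  also have "\<dots> = (\<Sum>k<n. \<Sum>i<n. B $$ (k, i) * A $$ (i, k))"
    by (subst sum.swap) (simp add: mult.commute)
  also have "\<dots> = mat_trace (B * A)"
    using assms unfolding mat_trace_def by (auto simp: mult_mat_index_sum[OF assms(2,1)] simp del: index_mult_mat(1))
  finally show ?thesis .
qed

text \<open>Conjugation respects products and linear combinations; this carries the polynomial to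
  the Schur form.\<close>

lemma nb_poly_mat_similar:
  assumes "P \<in> carrier_mat n n" "Q \<in> carrier_mat n n" "B \<in> carrier_mat n n"
    and "P * Q = 1\<^sub>m n" "Q * P = 1\<^sub>m n"
  shows "nb_poly_mat d (P * B * Q) k = P * nb_poly_mat d B k * Q"
proof (induction k rule: induct_nat_012)
  case 0
  show ?case using assms by simp
next
  case 1
  show ?case using assms by (simp add: mult_smult_distrib[of _ n n _ n] mult_smult_assoc_mat[of _ n n _ n])
next
  case (ge2 k)
  let ?M = "nb_poly_mat d B (Suc k)" and ?N = "nb_poly_mat d B k"
  have N: "?N \<in> carrier_mat n n" and BM: "B * ?M \<in> carrier_mat n n"
    using nb_poly_mat_carrier[OF assms(3)] mult_carrier_mat[OF assms(3)] by blast+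
  have "P * B * Q * (P * ?M * Q) = P * B * (Q * P) * ?M * Q"
    using nb_poly_mat_carrier[OF assms(3), of d "Suc k"]
    by (smt (verit) assms(1,2,3) assoc_mult_mat mult_carrier_mat)
  also have "\<dots> = P * (B * ?M) * Q"
    using nb_poly_mat_carrier[OF assms(3), of d "Suc k"] assms
    by (metis assoc_mult_mat mult_carrier_mat right_mult_one_mat)
  finally have 1: "P * B * Q * (P * ?M * Q) = P * (B * ?M) * Q" .
  have 2: "P * (B * ?M - ?N) * Q = P * (B * ?M) * Q - P * ?N * Q"
    unfolding mult_minus_distrib_mat[OF assms(1) BM N]
    by (rule minus_mult_distrib_mat[OF mult_carrier_mat[OF assms(1) BM] mult_carrier_mat[OF assms(1) N] assms(2)])
  have c: "B * ?M - ?N \<in> carrier_mat n n"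
    by (rule minus_carrier_mat[OF N])
  show ?case
    using c assms
    by (simp only: nb_poly_mat.simps ge2 1 2[symmetric] mult_smult_distrib[OF assms(1) c]
        mult_smult_assoc_mat[OF mult_carrier_mat[OF assms(1) c] assms(2)])
qed

lemma upper_triangular_mult:
  assumes "A \<in> carrier_mat n n" "B \<in> carrier_mat n n" "upper_triangular A" "upper_triangular B"
    and "i < n" "j \<le> i"
  shows "(A * B) $$ (i, j) = (if i = j then A $$ (i, i) * B $$ (i, i) else (0 :: real))"
proof -
  have "(A * B) $$ (i, j) = (\<Sum>k<n. A $$ (i, k) * B $$ (k, j))"
    using assms by (intro mult_mat_index_sum) auto
  also have "\<dots> = (\<Sum>k<n. if k = i then (if i = j then A $$ (i, i) * B $$ (i, i) else 0) else 0)"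
  proof (intro sum.cong refl)
    fix k assume "k \<in> {..<n}"
    then have "k < i \<Longrightarrow> A $$ (i, k) = 0" "j < k \<Longrightarrow> B $$ (k, j) = 0"
      using assms by (auto dest!: upper_triangularD)
    then show "A $$ (i, k) * B $$ (k, j) = (if k = i then if i = j then A $$ (i, i) * B $$ (i, i) else 0 else 0)"
      using assms by (cases "k < i"; cases "k = i"; cases "j = i") auto
  qed
  also have "\<dots> = (if i = j then A $$ (i, i) * B $$ (i, i) else 0)"
    using assms by (simp add: sum.delta)
  finally show ?thesis .
qed

text \<open>Entries above the diagonal stay open: the trace of a product of upper triangular
  matrices only involves the diagonals.\<close>

lemma nb_poly_mat_upper_triangular:
  assumes "B \<in> carrier_mat n n" "upper_triangular B" "i < n" "j \<le> i"
  shows "nb_poly_mat d B k $$ (i, j) = (if i = j then nb_poly d (B $$ (i, i)) k else 0)"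
  using assms(3,4)
proof (induction k arbitrary: i j rule: induct_nat_012)
  case 0
  then show ?case using assms(1) by simp
next
  case 1
  then show ?case using assms(1) upper_triangularD[OF assms(2), of j i] by (cases "i = j") auto
next
  case (ge2 k)
  note c = nb_poly_mat_carrier[OF assms(1)]
  have c': "dim_row (nb_poly_mat d B k) = n" "dim_col (nb_poly_mat d B k) = n" for k
    using c by blast+
  have "upper_triangular (nb_poly_mat d B (Suc k))"
    by (rule upper_triangularI) (use ge2.IH(2) c' in auto)
  then have "(B * nb_poly_mat d B (Suc k)) $$ (i, j) =
      (if i = j then B $$ (i, i) * nb_poly_mat d B (Suc k) $$ (i, i) else 0)"
    by (intro upper_triangular_mult[OF assms(1) c assms(2) _ ge2.prems])
  then show ?case
    using ge2 assms(1) c'[of k] c'[of "Suc k"]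
    by (auto simp del: index_mult_mat(1))
qed

text \<open>A product of symmetric matrices is symmetric once they commute; the symmetry proof below
  rests on this.\<close>

lemma nb_poly_mat_comm:
  assumes A: "A \<in> carrier_mat n n"
  shows "nb_poly_mat d A k * A = A * nb_poly_mat d A k"
proof (induction k rule: induct_nat_012)
  case (ge2 k)
  let ?M = "nb_poly_mat d A (Suc k)" and ?N = "nb_poly_mat d A k"
  have M: "?M \<in> carrier_mat n n" and N: "?N \<in> carrier_mat n n"
    using nb_poly_mat_carrier[OF A] by blast+
  have c: "A * ?M - ?N \<in> carrier_mat n n" by (rule minus_carrier_mat[OF N])
  have "(A * ?M - ?N) * A = A * ?M * A - ?N * A"
    by (rule minus_mult_distrib_mat[OF mult_carrier_mat[OF A M] N A])
  also have "\<dots> = A * (?M * A) - A * ?N"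
    by (simp only: assoc_mult_mat[OF A M A] ge2)
  also have "\<dots> = A * (A * ?M - ?N)"
    by (simp only: ge2 mult_minus_distrib_mat[OF A mult_carrier_mat[OF A M] N])
  finally show ?case
    by (simp add: mult_smult_distrib[OF A c] mult_smult_assoc_mat[OF c A])
qed (use A in \<open>simp_all add: mult_smult_distrib[OF A A] mult_smult_assoc_mat[OF A A]\<close>)

lemma transpose_smult_mat: "transpose_mat (c \<cdot>\<^sub>m A) = c \<cdot>\<^sub>m transpose_mat A"
  by (intro eq_matI) auto

lemma nb_poly_mat_symmetric:
  assumes A: "A \<in> carrier_mat n n" and s: "transpose_mat A = A"
  shows "transpose_mat (nb_poly_mat d A k) = nb_poly_mat d A k"
proof (induction k rule: induct_nat_012)
  case (ge2 k)
  let ?M = "nb_poly_mat d A (Suc k)" and ?N = "nb_poly_mat d A k"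
  have M: "?M \<in> carrier_mat n n" and N: "?N \<in> carrier_mat n n"
    using nb_poly_mat_carrier[OF A] by blast+
  have AM: "A * ?M \<in> carrier_mat n n" using A M by auto
  have "transpose_mat (A * ?M) = A * ?M"
    using transpose_mult[OF A M] ge2 s nb_poly_mat_comm[OF A, of d "Suc k"] by simp
  then have "transpose_mat (A * ?M - ?N) = A * ?M - ?N"
    using transpose_minus[OF AM N] ge2 by simp
  then show ?case by (metis nb_poly_mat.simps(3) transpose_smult_mat)
qed (use A s in \<open>simp_all add: transpose_smult_mat\<close>)

text \<open>Both sides are the trace of the squared polynomial: symmetry turns it into the sum of
  squared entries, and the Schur form exposes the eigenvalues on its diagonal.\<close>

lemma frobenius_nb_poly_mat:
  assumes A: "A \<in> carrier_mat n n" and s: "transpose_mat A = A"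
    and cp: "char_poly A = (\<Prod>e\<leftarrow>es. [:- e, 1:])"
  shows "(\<Sum>i<n. \<Sum>j<n. (nb_poly_mat d A k $$ (i, j))\<^sup>2) = (\<Sum>i<n. (nb_poly d (es ! i) k)\<^sup>2)"
proof -
  obtain B P Q where BPQ: "schur_decomposition A es = (B, P, Q)" by (metis prod_cases3)
  from schur_decomposition[OF A cp BPQ]
  have w: "similar_mat_wit A B P Q" and u: "upper_triangular B" and dg: "diag_mat B = es" by auto
  note w = similar_mat_witD2[OF A w]
  let ?H = "nb_poly_mat d A k" and ?T = "nb_poly_mat d B k"
  have H: "?H \<in> carrier_mat n n" and T: "?T \<in> carrier_mat n n" using A w by auto
  have sym: "?H $$ (j, i) = ?H $$ (i, j)" if "i < n" "j < n" for i j
    using nb_poly_mat_symmetric[OF A s, of d k] H that by (metis carrier_matD index_transpose_mat(1))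
  have "mat_trace (?H * ?H) = (\<Sum>i<n. \<Sum>j<n. (?H $$ (i, j))\<^sup>2)"
    using H unfolding mat_trace_def
    by (auto simp: mult_mat_index_sum[OF H H] sym power2_eq_square simp del: index_mult_mat(1) intro!: sum.cong)
  moreover have "mat_trace (?H * ?H) = mat_trace (?T * ?T)"
  proof -
    have "?H = P * ?T * Q" using w nb_poly_mat_similar[of P n Q B d k] by simp
    then have "?H * ?H = P * (?T * ?T * Q)"
      using w T by (smt (verit) assoc_mult_mat mult_carrier_mat right_mult_one_mat)
    moreover have "?T * ?T * Q \<in> carrier_mat n n" "P \<in> carrier_mat n n"
      using w mult_carrier_mat[OF mult_carrier_mat[OF T T]] by blast+
    ultimately have "mat_trace (?H * ?H) = mat_trace (?T * ?T * Q * P)"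
      using mat_trace_comm[of P n "?T * ?T * Q"] by (simp only:)
    also have "?T * ?T * Q * P = ?T * ?T"
      using w T by (smt (verit) assoc_mult_mat mult_carrier_mat right_mult_one_mat)
    finally show ?thesis .
  qed
  moreover have "mat_trace (?T * ?T) = (\<Sum>i<n. (nb_poly d (es ! i) k)\<^sup>2)"
  proof -
    have BC: "B \<in> carrier_mat n n" using w by simp
    have uT: "upper_triangular ?T"
      by (rule upper_triangularI) (use nb_poly_mat_upper_triangular[OF BC u] T in auto)
    have "es ! i = B $$ (i, i)" if "i < n" for i
      using dg BC that by (auto simp: diag_mat_def)
    then show ?thesis
      using T unfolding mat_trace_def
      by (auto simp: upper_triangular_mult[OF T T uT uT] nb_poly_mat_upper_triangular[OF BC u]
          power2_eq_square simp del: index_mult_mat(1))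
  qed
  ultimately show ?thesis by simp
qed

section \<open>Spectral gap and geometric decay of the polynomials\<close>

text \<open>\<open>z\<close> and \<open>w\<close> are the characteristic roots of the recurrence,
  with \<open>m = d - 1\<close>. Real roots share their sign, so
  \<open>(1 - |z|) (1 - |w|) = 1 - |x| / m + 1 / m\<close> is at least the normalised gap, and the
  product \<open>1 / m < 1\<close> keeps both moduli below 1. Non-real roots have equal real and
  opposite imaginary parts, so the squared modulus is \<open>1 / m \<le> 1 / 2\<close>, below
  \<open>(3 / 4)^2\<close>.\<close>

lemma real_sum_prod_root_bound:
  fixes z w :: complex and m x l :: real
  assumes zw: "z * w = of_real (1 / m)" "z + w = of_real (x / m)" and m: "m \<ge> 2"
    and x: "\<bar>x\<bar> \<le> l" and l: "l < m + 1"
  shows "cmod z \<le> max (1 - (m + 1 - l) / m) (3 / 4)"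
proof (cases "Im z = 0")
  case True
  then have Imw: "Im w = 0" using zw(2) by (metis Im_complex_of_real add_0 plus_complex.sel(2))
  define a b where "a = \<bar>Re z\<bar>" and "b = \<bar>Re w\<bar>"
  have p: "Re z * Re w = 1 / m" using zw(1) True Imw by (metis Re_complex_of_real diff_zero mult_zero_left times_complex.sel(1))
  have s: "Re z + Re w = x / m" using zw(2) by (metis Re_complex_of_real plus_complex.sel(1))
  have ab: "a * b = 1 / m" using p m unfolding a_def b_def by (simp flip: abs_mult)
  have "Re z * Re w > 0" using p m by simp
  then have "a + b = \<bar>x / m\<bar>" unfolding s[symmetric] a_def b_def
    by (auto simp: zero_less_mult_iff)
  then have sum: "a + b \<le> l / m" using x m by (simp add: divide_right_mono)
  have a0: "a \<ge> 0" "b \<ge> 0" by (auto simp: a_def b_def)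
  have g: "(1 - a) * (1 - b) \<ge> (m + 1 - l) / m"
  proof -
    have "(1 - a) * (1 - b) = 1 - (a + b) + 1 / m" using ab by (simp add: algebra_simps)
    also have "\<dots> \<ge> 1 - l / m + 1 / m" using sum by simp
    finally show ?thesis using m by (simp add: field_simps)
  qed
  have gp: "(m + 1 - l) / m > 0" using m l by simp
  have "\<not> a \<ge> 1"
  proof
    assume "a \<ge> 1"
    moreover have "(1 - a) * (1 - b) > 0" using g gp by linarith
    ultimately have "b > 1" by (auto simp: zero_less_mult_iff)
    then have "1 * 1 < a * b" using \<open>a \<ge> 1\<close> by (intro mult_le_less_imp_less) auto
    then show False using ab m by (simp add: field_simps)
  qed
  then have "(1 - a) * (1 - b) \<le> 1 - a" using a0 by (simp add: mult_left_le)
  then have "a \<le> 1 - (m + 1 - l) / m" using g by linarith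
  moreover have "cmod z = a" using True by (simp add: a_def cmod_def)
  ultimately show ?thesis by simp
next
  case False
  have i: "Im w = - Im z" using zw(2) by (metis Im_complex_of_real add_eq_0_iff plus_complex.sel(2))
  have "Re z * Im w + Im z * Re w = 0" using zw(1) by (metis Im_complex_of_real times_complex.sel(2))
  then have r: "Re w = Re z" using False i by (simp add: algebra_simps)
  have "Re z * Re w - Im z * Im w = 1 / m" using zw(1) by (metis Re_complex_of_real times_complex.sel(1))
  then have "(cmod z)\<^sup>2 = 1 / m" using i r unfolding cmod_power2 by (simp add: power2_eq_square)
  also have "\<dots> \<le> (3/4)\<^sup>2" using m by (simp add: field_simps power2_eq_square)
  finally have "cmod z \<le> 3 / 4" by (rule power2_le_imp_le) simp
  then show ?thesis by simp
qed

text \<open>\<open>\<rho>\<close> lies strictly between the root bound \<open>r\<close> and 1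
  because nearly equal roots produce terms like \<open>k r^k\<close>. \<open>C\<close> is chosen so
  that \<open>2 \<le> C (\<rho> - r)\<close>, which closes the induction. The floor
  \<open>3 / 4\<close> on \<open>\<rho>\<close> serves the later inductions that transfer the decay
  to states.\<close>

lemma nb_poly_decay:
  fixes d lam :: real
  assumes d: "d \<ge> 3" and lam: "lam < d"
  obtains C \<rho> where "C \<ge> 1" "3/4 \<le> \<rho>" "\<rho> < 1"
    "\<And>x k. \<bar>x\<bar> \<le> lam \<Longrightarrow> \<bar>nb_poly d x k\<bar> \<le> C * \<rho> ^ k"
proof -
  define r where "r = max (1 - (d - lam) / (d - 1)) (3 / 4)"
  define \<rho> where "\<rho> = (1 + r) / 2"
  have r: "3/4 \<le> r" "r < 1" unfolding r_def using d lam by (auto simp: field_simps)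
  have \<rho>: "r < \<rho>" "\<rho> < 1" using r by (auto simp: \<rho>_def)
  define C where "C = 2 / (\<rho> - r) + 1"
  have "C * D = 2 + D" if "D = \<rho> - r" for D
    using \<rho> that[symmetric] unfolding C_def by (simp add: distrib_right)
  then have C: "C \<ge> 1" "2 \<le> C * (\<rho> - r)" using \<rho> by (auto simp: C_def)
  have "\<bar>nb_poly d x k\<bar> \<le> C * \<rho> ^ k" if x: "\<bar>x\<bar> \<le> lam" for x k
  proof -
    define z where "z = (of_real (x / (d - 1)) + csqrt ((of_real (x / (d - 1)))\<^sup>2 - 4 * of_real (1 / (d - 1)))) / 2"
    define w where "w = of_real (x / (d - 1)) - z"
    have sw: "z + w = of_real (x / (d - 1))" by (simp add: w_def)
    have pw: "z * w = of_real (1 / (d - 1))"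
    proof -
      define s where "s = csqrt ((of_real (x / (d - 1)))\<^sup>2 - 4 * of_real (1 / (d - 1)))"
      have "s\<^sup>2 = (of_real (x / (d - 1)))\<^sup>2 - 4 * of_real (1 / (d - 1))" by (simp add: s_def)
      moreover have "4 * (z * w) = (of_real (x / (d - 1)))\<^sup>2 - s\<^sup>2"
        unfolding w_def z_def s_def[symmetric]
        by (simp add: field_simps power2_eq_square del: of_real_divide of_real_diff)
      ultimately have "4 * (z * w) = 4 * of_real (1 / (d - 1))" by simp
      then show ?thesis unfolding mult_cancel_left by simp
    qed
    have z: "cmod z \<le> r" using real_sum_prod_root_bound[OF pw sw _ x] d lam by (simp add: r_def)
    have w: "cmod w \<le> r" using real_sum_prod_root_bound[of w z "d - 1", OF _ _ _ x] pw sw d lam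
      by (simp add: r_def mult.commute add.commute)
    define y where "y k = complex_of_real (nb_poly d x k)" for k
    have y_rec: "y (Suc (Suc k)) = (z + w) * y (Suc k) - z * w * y k" for k
    proof -
      have "nb_poly d x (Suc (Suc k)) = x / (d - 1) * nb_poly d x (Suc k) - 1 / (d - 1) * nb_poly d x k"
        by (simp add: diff_divide_distrib)
      then show ?thesis unfolding sw pw y_def by (simp only: of_real_mult of_real_diff)
    qed
    have y1: "cmod (y 1) \<le> 1"
      unfolding y_def norm_of_real using x lam d by (simp add: abs_divide)
    \<comment> \<open>Subtracting \<open>z * y k\<close> factors the second-order recurrence: the
      remainder is geometric with ratio \<open>w\<close>.\<close>
    have diff: "cmod (y (Suc k) - z * y k) \<le> 2 * r ^ k" for k
    proof (induction k)
      case 0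
      have "cmod (y 1 - z * y 0) \<le> cmod (y 1) + cmod z" using norm_triangle_ineq4[of "y 1" "z * y 0"]
        by (simp add: y_def)
      then show ?case using y1 z r by simp
    next
      case (Suc k)
      have "y (Suc (Suc k)) - z * y (Suc k) = w * (y (Suc k) - z * y k)"
        unfolding y_rec by (simp add: algebra_simps)
      then have "cmod (y (Suc (Suc k)) - z * y (Suc k)) = cmod w * cmod (y (Suc k) - z * y k)"
        by (simp add: norm_mult)
      also have "\<dots> \<le> r * (2 * r ^ k)" by (intro mult_mono w Suc) (use r in auto)
      finally show ?case by simp
    qed
    have "cmod (y k) \<le> C * \<rho> ^ k"
    proof (induction k)
      case 0
      then show ?case using C by (simp add: y_def)
    next
      case (Suc k)
      have "cmod (y (Suc k)) \<le> cmod z * cmod (y k) + cmod (y (Suc k) - z * y k)"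
        by (metis add.commute diff_add_cancel norm_mult norm_triangle_ineq)
      also have "\<dots> \<le> r * (C * \<rho> ^ k) + 2 * r ^ k"
        by (intro add_mono mult_mono z Suc diff) (use r in auto)
      also have "\<dots> \<le> r * (C * \<rho> ^ k) + 2 * \<rho> ^ k"
        using r \<rho> by (simp add: power_mono)
      also have "\<dots> \<le> r * (C * \<rho> ^ k) + C * (\<rho> - r) * \<rho> ^ k"
        using C \<rho> r by (intro add_left_mono mult_right_mono) auto
      also have "\<dots> = C * \<rho> ^ Suc k" by (simp add: algebra_simps)
      finally show ?case .
    qed
    then show ?thesis by (simp add: y_def)
  qed
  then show thesis using that C \<rho> r by (meson less_imp_le order_trans)
qed

text \<open>The trivial eigenvalue contributes exactly 1 to the trace, the share of the uniform
  distribution.\<close>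

lemma nb_poly_degree: "d > 1 \<Longrightarrow> nb_poly d d k = 1"
  by (induction k rule: induct_nat_012) simp_all

section \<open>Mixing of the non-backtracking walk\<close>

locale nb_graph = pair_graph G for G :: "'a pair_pre_digraph" +
  fixes d :: nat
  assumes deg: "v \<in> pverts G \<Longrightarrow> card (neighbors G v) = d"
    and d3: "d \<ge> 3"
begin

abbreviation "V \<equiv> pverts G"
abbreviation "E \<equiv> parcs G"

definition succs :: "'a \<times> 'a \<Rightarrow> 'a set" where
  "succs e = neighbors G (snd e) - {fst e}"

lemma neighbors_iff: "w \<in> neighbors G v \<longleftrightarrow> (v, w) \<in> E"
  by (simp add: neighbors_def)

lemma neighbors_sym: "w \<in> neighbors G v \<longleftrightarrow> v \<in> neighbors G w"
  by (auto simp: neighbors_iff intro: arcs_symmetric)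

lemma neighbors_subset: "neighbors G v \<subseteq> V"
  by (auto simp: neighbors_iff dest: in_arcsD2)

lemma finite_neighbors [simp]: "finite (neighbors G v)"
  using neighbors_subset pair_finite_verts by (rule finite_subset)

lemma finite_succs [simp]: "finite (succs e)"
  by (simp add: succs_def)

lemma card_succs: "e \<in> E \<Longrightarrow> card (succs e) = d - 1"
  using deg[of "snd e"] neighbors_sym[of "fst e" "snd e"]
  by (auto simp: succs_def neighbors_iff dest: arc_snd_in_verts)

lemma real_card_succs: "e \<in> E \<Longrightarrow> real (card (succs e)) = real d - 1"
  using d3 by (simp add: card_succs)

lemma succs_arc: "c \<in> succs e \<Longrightarrow> (snd e, c) \<in> E"
  by (simp add: succs_def neighbors_iff)

lemma card_arcs: "card E = card V * d"
proof -
  have "E = Sigma V (neighbors G)"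
    by (auto simp: neighbors_iff dest: in_arcsD1)
  then show ?thesis using pair_finite_verts by (simp add: deg)
qed

text \<open>The state \<open>(a, b)\<close> means that the walk is at \<open>b\<close> and came from \<open>a\<close>. \<open>wmean k e \<Phi>\<close> is the expectation
  of \<open>\<Phi> l f\<close>, where \<open>l\<close> lists the next \<open>k\<close> vertices and \<open>f\<close> is the final state.\<close>

primrec wmean :: "nat \<Rightarrow> 'a \<times> 'a \<Rightarrow> ('a list \<Rightarrow> 'a \<times> 'a \<Rightarrow> real) \<Rightarrow> real" where
  "wmean 0 e \<Phi> = \<Phi> [] e"
| "wmean (Suc k) e \<Phi> = (\<Sum>c\<in>succs e. wmean k (snd e, c) (\<lambda>l. \<Phi> (c # l))) / (real d - 1)"

lemma d_minus_1_pos: "real d - 1 > 0"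
  using d3 by simp

lemma wmean_mono:
  assumes "e \<in> E"
    and "\<And>l f. length l = k \<Longrightarrow> set l \<subseteq> V \<Longrightarrow> f \<in> E \<Longrightarrow> \<Phi> l f \<le> \<Psi> l f"
  shows "wmean k e \<Phi> \<le> wmean k e \<Psi>"
  using assms
proof (induction k arbitrary: e \<Phi> \<Psi>)
  case (Suc k)
  have "wmean k (snd e, c) (\<lambda>l. \<Phi> (c # l)) \<le> wmean k (snd e, c) (\<lambda>l. \<Psi> (c # l))" if "c \<in> succs e" for c
    using succs_arc[OF that] by (intro Suc.IH Suc.prems(2)) (auto dest: in_arcsD2)
  then show ?case using d_minus_1_pos by (auto intro!: divide_right_mono sum_mono)
qed simp

lemma wmean_cong:
  assumes "e \<in> E"
    and "\<And>l f. length l = k \<Longrightarrow> set l \<subseteq> V \<Longrightarrow> f \<in> E \<Longrightarrow> \<Phi> l f = \<Psi> l f"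
  shows "wmean k e \<Phi> = wmean k e \<Psi>"
  using assms by (intro antisym wmean_mono) auto

lemma wmean_cmult: "wmean k e (\<lambda>l f. c * \<Phi> l f) = c * wmean k e \<Phi>"
  by (induction k arbitrary: e \<Phi>) (auto simp: sum_distrib_left)

lemma wmean_add: "wmean k e (\<lambda>l f. \<Phi> l f + \<Psi> l f) = wmean k e \<Phi> + wmean k e \<Psi>"
  by (induction k arbitrary: e \<Phi> \<Psi>) (auto simp: sum.distrib add_divide_distrib)

lemma wmean_const: "e \<in> E \<Longrightarrow> wmean k e (\<lambda>l f. c) = c"
proof (induction k arbitrary: e)
  case (Suc k)
  then show ?case using d_minus_1_pos by (simp add: succs_arc real_card_succs)
qed simp

lemma wmean_sum: "finite A \<Longrightarrow> wmean k e (\<lambda>l f. \<Sum>x\<in>A. \<Phi> x l f) = (\<Sum>x\<in>A. wmean k e (\<Phi> x))"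
proof (induction A rule: finite_induct)
  case empty
  show ?case using wmean_cmult[of k e 0 "\<lambda>_ _. 0"] by simp
qed (simp add: wmean_add)

lemma wmean_append: "wmean (j + k) e \<Phi> = wmean j e (\<lambda>l f. wmean k f (\<lambda>l'. \<Phi> (l @ l')))"
  by (induction j arbitrary: e \<Phi>) auto

section \<open>Position and arc distributions of the walk\<close>

definition hit :: "nat \<Rightarrow> 'a \<times> 'a \<Rightarrow> 'a \<Rightarrow> real" where
  "hit k e v = wmean k e (\<lambda>_ f. of_bool (snd f = v))"

definition dart :: "nat \<Rightarrow> 'a \<times> 'a \<Rightarrow> 'a \<times> 'a \<Rightarrow> real" where
  "dart k e f = wmean k e (\<lambda>_ f'. of_bool (f' = f))"

text \<open>\<open>fresh k b v\<close>: the probability that a walk started at \<open>b\<close>, without a previous vertex, is at \<open>v\<close> after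
  \<open>k\<close> steps.\<close>

primrec fresh :: "nat \<Rightarrow> 'a \<Rightarrow> 'a \<Rightarrow> real" where
  "fresh 0 b v = of_bool (b = v)"
| "fresh (Suc k) b v = (\<Sum>c\<in>neighbors G b. hit k (b, c) v) / real d"

lemma hit_0: "hit 0 e v = of_bool (snd e = v)"
  by (simp add: hit_def)

lemma hit_Suc: "hit (Suc k) e v = (\<Sum>c\<in>succs e. hit k (snd e, c) v) / (real d - 1)"
  by (simp add: hit_def)

lemma dart_0: "dart 0 e f = of_bool (e = f)"
  by (simp add: dart_def)

lemma hit_nonneg: "hit k e v \<ge> 0"
  by (induction k arbitrary: e) (use d_minus_1_pos in \<open>auto simp: hit_0 hit_Suc intro!: divide_nonneg_pos sum_nonneg\<close>)

lemma hit_le_1: "e \<in> E \<Longrightarrow> hit k e v \<le> 1"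
  using wmean_mono[of e k "\<lambda>_ f. of_bool (snd f = v)" "\<lambda>_ _. 1"] by (simp add: wmean_const hit_def)

lemma sum_hit: "e \<in> E \<Longrightarrow> (\<Sum>v\<in>V. hit k e v) = 1"
proof -
  assume e: "e \<in> E"
  have "(\<Sum>v\<in>V. hit k e v) = wmean k e (\<lambda>_ f. \<Sum>v\<in>V. of_bool (snd f = v))"
    unfolding hit_def by (rule wmean_sum[OF pair_finite_verts, symmetric])
  also have "\<dots> = wmean k e (\<lambda>_ _. 1)"
    using e pair_finite_verts by (intro wmean_cong) (auto simp: of_bool_def arc_snd_in_verts)
  finally show ?thesis using e by (simp add: wmean_const)
qed

lemma sum_fresh: "b \<in> V \<Longrightarrow> (\<Sum>v\<in>V. fresh k b v) = 1"
proof (cases k)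
  case (Suc j)
  assume b: "b \<in> V"
  have "(\<Sum>v\<in>V. fresh k b v) = (\<Sum>c\<in>neighbors G b. \<Sum>v\<in>V. hit j (b, c) v) / real d"
    unfolding Suc by (simp flip: sum_divide_distrib) (subst sum.swap, simp)
  also have "\<dots> = 1" using b d3 by (simp add: sum_hit neighbors_iff deg)
  finally show ?thesis .
qed (use pair_finite_verts in \<open>auto simp: of_bool_def\<close>)

text \<open>A step to any of the \<open>d\<close> neighbours of \<open>b\<close>, minus the step
  back to \<open>a\<close>, leaves the steps allowed from \<open>(a, b)\<close>.\<close>

lemma hit_Suc_fresh:
  assumes "(a, b) \<in> E"
  shows "hit (Suc k) (a, b) v = (real d * fresh (Suc k) b v - hit k (b, a) v) / (real d - 1)"
proof -
  have "a \<in> neighbors G b" using assms by (simp add: neighbors_iff arcs_symmetric)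
  then have "(\<Sum>c\<in>neighbors G b. hit k (b, c) v) = hit k (b, a) v + (\<Sum>c\<in>succs (a, b). hit k (b, c) v)"
    by (simp add: succs_def sum.remove)
  then show ?thesis using d3 by (simp add: hit_Suc)
qed

text \<open>Averaging over the predecessor of \<open>b\<close> erases its influence: the forbidden
  neighbour is uniform, hence so is the first step.\<close>

lemma sum_hit_in: "b \<in> V \<Longrightarrow> (\<Sum>c\<in>neighbors G b. hit k (c, b) v) = real d * fresh k b v"
proof (cases k)
  case 0
  assume "b \<in> V"
  then show ?thesis by (simp add: 0 hit_0 deg)
next
  case (Suc j)
  assume b: "b \<in> V"
  have "(\<Sum>c\<in>neighbors G b. hit k (c, b) v) =
      (\<Sum>c\<in>neighbors G b. (real d * fresh (Suc j) b v - hit j (b, c) v) / (real d - 1))"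
    unfolding Suc by (intro sum.cong refl hit_Suc_fresh) (auto simp: neighbors_iff arcs_symmetric)
  also have "\<dots> = (real d * (real d * fresh (Suc j) b v) - (\<Sum>c\<in>neighbors G b. hit j (b, c) v)) / (real d - 1)"
    using b by (simp add: sum_subtractf deg flip: sum_divide_distrib)
  also have "(\<Sum>c\<in>neighbors G b. hit j (b, c) v) = real d * fresh (Suc j) b v"
    using d3 by simp
  also have "(real d * (real d * fresh (Suc j) b v) - real d * fresh (Suc j) b v) / (real d - 1) = real d * fresh k b v"
    using d_minus_1_pos unfolding Suc by (simp add: divide_simps) (simp add: algebra_simps)
  finally show ?thesis .
qed

text \<open>One free step, with the backtracking correction of \<open>hit_Suc_fresh\<close> summed
  by \<open>sum_hit_in\<close>. The result is the recurrence of \<open>nb_poly\<close>.\<close>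

lemma fresh_rec:
  assumes b: "b \<in> V"
  shows "fresh (Suc (Suc k)) b v = ((\<Sum>c\<in>neighbors G b. fresh (Suc k) c v) - fresh k b v) / (real d - 1)"
proof -
  have "fresh (Suc (Suc k)) b v = (\<Sum>c\<in>neighbors G b. (real d * fresh (Suc k) c v - hit k (c, b) v) / (real d - 1)) / real d"
    unfolding fresh.simps(2)[of "Suc k"] by (intro arg_cong2[where f = "(/)"] sum.cong refl hit_Suc_fresh) (auto simp: neighbors_iff)
  also have "\<dots> = (real d * (\<Sum>c\<in>neighbors G b. fresh (Suc k) c v) - real d * fresh k b v) / (real d - 1) / real d"
    using sum_hit_in[OF b, of k v] by (simp add: sum_subtractf sum_distrib_left flip: sum_divide_distrib)
  also have "\<dots> = ((\<Sum>c\<in>neighbors G b. fresh (Suc k) c v) - fresh k b v) / (real d - 1)"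
    using d3 by (simp flip: right_diff_distrib)
  finally show ?thesis .
qed

text \<open>To traverse \<open>(p, q)\<close> last, the walk must be at \<open>p\<close> without
  having come from \<open>q\<close>; it then picks \<open>q\<close> with probability
  \<open>1 / (d - 1)\<close>.\<close>

lemma dart_Suc:
  assumes e: "e \<in> E" and pq: "(p, q) \<in> E"
  shows "dart (Suc k) e (p, q) = (hit k e p - dart k e (q, p)) / (real d - 1)"
proof -
  have *: "(\<Sum>c\<in>succs f. of_bool ((snd f, c) = (p, q))) / (real d - 1) =
      (of_bool (snd f = p) + - 1 * of_bool (f = (q, p))) / (real d - 1)" if f: "f \<in> E" for f
  proof -
    have "(\<Sum>c\<in>succs f. of_bool ((snd f, c) = (p, q))) = (\<Sum>c\<in>succs f. if c = q then of_bool (snd f = p) else (0::real))"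
      by (intro sum.cong) auto
    also have "\<dots> = (if q \<in> succs f then of_bool (snd f = p) else 0)" by simp
    also have "\<dots> = of_bool (snd f = p) + - 1 * of_bool (f = (q, p))"
      using f pq by (cases f) (auto simp: succs_def neighbors_iff)
    finally show ?thesis by simp
  qed
  have "dart (Suc k) e (p, q) = wmean k e (\<lambda>_ f. (\<Sum>c\<in>succs f. of_bool ((snd f, c) = (p, q))) / (real d - 1))"
    using wmean_append[of k 1 e "\<lambda>_ f'. of_bool (f' = (p, q))"] by (simp add: dart_def)
  also have "\<dots> = wmean k e (\<lambda>_ f. 1 / (real d - 1) * (of_bool (snd f = p) + - 1 * of_bool (f = (q, p))))"
    by (intro wmean_cong e, subst *) simp_all
  also have "\<dots> = 1 / (real d - 1) * (hit k e p + - 1 * dart k e (q, p))"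
    unfolding wmean_cmult wmean_add hit_def dart_def by simp
  finally show ?thesis by simp
qed

text \<open>Stationarity of the uniform law on arcs, seen through its vertex marginal.\<close>

lemma sum_hit_arcs:
  assumes v: "v \<in> V"
  shows "(\<Sum>e\<in>E. hit k e v) = real d"
proof (induction k)
  case 0
  have "(\<Sum>e\<in>E. hit 0 e v) = (\<Sum>e\<in>{e\<in>E. snd e = v}. 1)"
    using pair_finite_arcs by (subst sum.inter_filter) (auto simp: hit_0 of_bool_def intro!: sum.cong)
  also have "{e\<in>E. snd e = v} = (\<lambda>c. (c, v)) ` neighbors G v"
    by (auto simp: neighbors_iff image_iff intro: arcs_symmetric)
  also have "(\<Sum>e\<in>(\<lambda>c. (c, v)) ` neighbors G v. 1) = real d"
    using v by (simp add: card_image inj_on_def deg)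
  finally show ?case .
next
  case (Suc k)
  have E: "E = Sigma V (neighbors G)" by (auto simp: neighbors_iff dest: in_arcsD1)
  have E': "E = (\<lambda>(b, a). (a, b)) ` Sigma V (neighbors G)"
    by (auto simp: neighbors_iff image_iff Bex_def dest: in_arcsD1 in_arcsD2 intro: arcs_symmetric)
  have inj: "inj_on (\<lambda>(b, a). (a, b)) (Sigma V (neighbors G))" by (auto simp: inj_on_def)
  have "(\<Sum>e\<in>E. hit (Suc k) e v) = (\<Sum>x\<in>Sigma V (neighbors G). hit (Suc k) (snd x, fst x) v)"
    by (subst E', subst sum.reindex[OF inj]) (simp add: case_prod_unfold)
  also have "\<dots> = (\<Sum>b\<in>V. \<Sum>a\<in>neighbors G b. hit (Suc k) (a, b) v)"
    using pair_finite_verts by (subst sum.Sigma) (auto simp: case_prod_unfold)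
  also have "\<dots> = (\<Sum>b\<in>V. \<Sum>c\<in>neighbors G b. hit k (b, c) v)"
    by (rule sum.cong[OF refl]) (use d3 in \<open>simp add: sum_hit_in\<close>)
  also have "\<dots> = (\<Sum>e\<in>E. hit k e v)"
    unfolding E using pair_finite_verts by (subst sum.Sigma) (auto simp: case_prod_unfold)
  finally show ?case using Suc by simp
qed

section \<open>Transition probabilities and the adjacency spectrum\<close>

lemma sum_indexed_vertices:
  assumes "distinct vs" "set vs = V"
  shows "(\<Sum>l<length vs. F (vs ! l)) = (\<Sum>v\<in>V. (F v :: real))"
  using sum.reindex_bij_betw[OF bij_betw_nth[OF assms(1) refl assms(2)[symmetric]], of F] by simp

lemma sum_adjacent: "(\<Sum>v\<in>V. (if (b, v) \<in> E then 1 else 0) * F v) = (\<Sum>c\<in>neighbors G b. (F c :: real))"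
proof -
  have "(\<Sum>v\<in>V. (if (b, v) \<in> E then 1 else 0) * F v) = (\<Sum>v\<in>V. if (b, v) \<in> E then F v else 0)"
    by (intro sum.cong) auto
  also have "\<dots> = (\<Sum>v\<in>{v\<in>V. (b, v) \<in> E}. F v)"
    using pair_finite_verts by (rule sum.inter_filter[symmetric])
  also have "{v\<in>V. (b, v) \<in> E} = neighbors G b"
    by (auto simp: neighbors_iff dest: in_arcsD2)
  finally show ?thesis .
qed

lemma nb_poly_mat_adjacency:
  assumes vs: "distinct vs" "set vs = V" and "i < length vs" "j < length vs"
  shows "nb_poly_mat (real d) (adjacency_matrix G vs) k $$ (i, j) = fresh k (vs ! i) (vs ! j)"
  using assms(3,4)
proof (induction k arbitrary: i j rule: induct_nat_012)
  case 0
  then show ?case using vs by (simp add: adjacency_matrix_def nth_eq_iff_index_eq)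
next
  case 1
  have "(\<Sum>c\<in>neighbors G (vs ! i). hit 0 (vs ! i, c) (vs ! j)) =
      (\<Sum>c\<in>neighbors G (vs ! i). if c = vs ! j then 1 else 0)"
    by (intro sum.cong) (auto simp: hit_0)
  also have "\<dots> = (if (vs ! i, vs ! j) \<in> E then 1 else 0)"
    by (simp add: neighbors_iff)
  finally show ?case using 1 by (simp add: adjacency_matrix_def)
next
  case (ge2 k)
  let ?n = "length vs" and ?A = "adjacency_matrix G vs"
  have A: "?A \<in> carrier_mat ?n ?n" by (simp add: adjacency_matrix_def)
  have M: "nb_poly_mat (real d) ?A k \<in> carrier_mat ?n ?n" for k
    by (rule nb_poly_mat_carrier[OF A])
  have "(?A * nb_poly_mat (real d) ?A (Suc k)) $$ (i, j) =
      (\<Sum>l<?n. ?A $$ (i, l) * nb_poly_mat (real d) ?A (Suc k) $$ (l, j))"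
    using ge2.prems by (intro mult_mat_index_sum[OF A M])
  also have "\<dots> = (\<Sum>l<?n. (if (vs ! i, vs ! l) \<in> E then 1 else 0) * fresh (Suc k) (vs ! l) (vs ! j))"
    using ge2.prems by (intro sum.cong refl arg_cong2[where f = "(*)"] ge2.IH) (auto simp: adjacency_matrix_def)
  also have "\<dots> = (\<Sum>c\<in>neighbors G (vs ! i). fresh (Suc k) c (vs ! j))"
    unfolding sum_indexed_vertices[OF vs, of "\<lambda>v. (if (vs ! i, v) \<in> E then 1 else 0) * fresh (Suc k) v (vs ! j)"]
    by (rule sum_adjacent)
  finally have *: "(?A * nb_poly_mat (real d) ?A (Suc k)) $$ (i, j) = (\<Sum>c\<in>neighbors G (vs ! i). fresh (Suc k) c (vs ! j))" .
  have "dim_row (nb_poly_mat (real d) ?A k) = ?n" "dim_col (nb_poly_mat (real d) ?A k) = ?n" for k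
    using M by blast+
  then have "nb_poly_mat (real d) ?A (Suc (Suc k)) $$ (i, j) =
      ((?A * nb_poly_mat (real d) ?A (Suc k)) $$ (i, j) - nb_poly_mat (real d) ?A k $$ (i, j)) / (real d - 1)"
    using ge2.prems A unfolding nb_poly_mat.simps by (simp del: index_mult_mat(1) nb_poly_mat.simps)
  also have "\<dots> = fresh (Suc (Suc k)) (vs ! i) (vs ! j)"
    unfolding * ge2.IH(1)[OF ge2.prems]
    by (rule fresh_rec[symmetric]) (use ge2.prems(1) vs(2) nth_mem in blast)
  finally show ?case .
qed

text \<open>Witnessed by the all-ones vector. It places \<open>d\<close> in the eigenvalue list,
  where the bound \<open>lam\<close> only concerns the entries after the first.\<close>

lemma adjacency_eigenvalue:
  assumes vs: "distinct vs" "set vs = V" "vs \<noteq> []"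
  shows "eigenvalue (adjacency_matrix G vs) (real d)"
proof -
  let ?n = "length vs" and ?A = "adjacency_matrix G vs"
  have "eigenvector ?A (vec ?n (\<lambda>_. 1)) (real d)"
    unfolding eigenvector_def
  proof (intro conjI)
    show "vec ?n (\<lambda>_. 1) \<in> carrier_vec (dim_row ?A)" by (simp add: adjacency_matrix_def)
    show "vec ?n (\<lambda>_. 1::real) \<noteq> 0\<^sub>v (dim_row ?A)"
    proof
      assume "vec ?n (\<lambda>_. 1::real) = 0\<^sub>v (dim_row ?A)"
      then have "vec ?n (\<lambda>_. 1::real) $ 0 = 0\<^sub>v (dim_row ?A) $ 0" by simp
      then show False using vs(3) by (simp add: adjacency_matrix_def)
    qed
    show "?A *\<^sub>v vec ?n (\<lambda>_. 1) = real d \<cdot>\<^sub>v vec ?n (\<lambda>_. 1)"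
    proof (rule eq_vecI)
      fix i assume "i < dim_vec (real d \<cdot>\<^sub>v vec ?n (\<lambda>_. 1))"
      then have i: "i < ?n" by simp
      have "(?A *\<^sub>v vec ?n (\<lambda>_. 1)) $ i = (\<Sum>l<?n. (if (vs ! i, vs ! l) \<in> E then 1 else 0) * 1)"
        using i by (auto simp: adjacency_matrix_def scalar_prod_def atLeast0LessThan intro!: sum.cong)
      also have "\<dots> = real d"
        unfolding sum_indexed_vertices[OF vs(1,2), of "\<lambda>v. (if (vs ! i, v) \<in> E then 1 else 0) * 1"] sum_adjacent
        using deg[of "vs ! i"] nth_mem[OF i] vs(2) by simp
      finally show "(?A *\<^sub>v vec ?n (\<lambda>_. 1)) $ i = (real d \<cdot>\<^sub>v vec ?n (\<lambda>_. 1)) $ i" using i by simp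
    qed (simp add: adjacency_matrix_def)
  qed
  then show ?thesis by (auto simp: eigenvalue_def)
qed

text \<open>One deviation is bounded by the Frobenius norm of the difference from the uniform
  matrix. Losing powers of \<open>n\<close> is harmless, since \<open>K\<close> may be any constant
  multiple of \<open>ln n\<close>.\<close>

lemma fresh_mixing:
  assumes ndl: "ndl_graph n d lam G" and n: "n \<ge> 2" and lam: "lam < real d"
    and decay: "\<And>x k. \<bar>x\<bar> \<le> lam \<Longrightarrow> \<bar>nb_poly (real d) x k\<bar> \<le> C * \<rho> ^ k"
    and bv: "b \<in> V" "v \<in> V"
  shows "\<bar>fresh k b v - 1 / real n\<bar> \<le> real n * (C * \<rho> ^ k)"
proof -
  from ndl obtain vs es where vs: "distinct vs" "set vs = V"
    and es: "ordered_eigenvalues (adjacency_matrix G vs) es"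
    and mx: "Max ((\<lambda>i. \<bar>es ! i\<bar>) ` {1..<n}) = lam" and cV: "card V = n"
    unfolding ndl_graph_def by auto
  let ?A = "adjacency_matrix G vs"
  have len: "length vs = n" using vs cV distinct_card by fastforce
  have A: "?A \<in> carrier_mat n n" by (simp add: adjacency_matrix_def len)
  have sym: "transpose_mat ?A = ?A"
    by (rule eq_matI) (auto simp: adjacency_matrix_def intro: arcs_symmetric)
  have cp: "char_poly ?A = (\<Prod>e\<leftarrow>es. [:- e, 1:])" using es by (simp add: ordered_eigenvalues_def)
  have les: "length es = n"
    using degree_monic_char_poly[OF A] unfolding cp by (simp add: degree_linear_factors)
  have small: "\<bar>es ! i\<bar> \<le> lam" if "i \<in> {1..<n}" for i
    using Max_ge[OF finite_imageI[OF finite_atLeastLessThan] imageI[OF that], of "\<lambda>i. \<bar>es ! i\<bar>"] mx by simp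
  have "vs \<noteq> []" using n len by auto
  from eigenvalue_root_char_poly[OF A, THEN iffD1, OF adjacency_eigenvalue[OF vs this]]
  have "0 \<in> set (map (\<lambda>e. real d - e) es)"
    unfolding cp poly_prod_list by (simp add: prod_list_zero_iff comp_def)
  then have "real d \<in> set es" by auto
  then obtain i where i: "i < n" "es ! i = real d" by (metis in_set_conv_nth les)
  \<comment> \<open>All later eigenvalues are at most \<open>lam < d\<close> in modulus, so
    \<open>d\<close> can only sit at index 0.\<close>
  with small[of i] lam have "i = 0" by (cases i) auto
  with i have es0: "es ! 0 = real d" by simp
  \<comment> \<open>\<open>C\<close> and \<open>\<rho>\<close> carry no sign here; nonnegativity
    comes from the decay bound at an actual eigenvalue, available as
    \<open>n \<ge> 2\<close>.\<close>
  have "\<bar>es ! 1\<bar> \<le> lam" using small[of 1] n by simp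
  then have Cr: "0 \<le> C * \<rho> ^ k" using decay[of "es ! 1" k] by linarith
  have "(\<Sum>b\<in>V. \<Sum>v\<in>V. (fresh k b v)\<^sup>2) = (\<Sum>i<n. \<Sum>j<n. (nb_poly_mat (real d) ?A k $$ (i, j))\<^sup>2)"
  proof -
    have "(\<Sum>i<n. \<Sum>j<n. (nb_poly_mat (real d) ?A k $$ (i, j))\<^sup>2) = (\<Sum>i<n. \<Sum>j<n. (fresh k (vs ! i) (vs ! j))\<^sup>2)"
      using nb_poly_mat_adjacency[OF vs] len by (intro sum.cong refl) auto
    also have "\<dots> = (\<Sum>i<n. \<Sum>v\<in>V. (fresh k (vs ! i) v)\<^sup>2)"
      using sum_indexed_vertices[OF vs, of "\<lambda>v. (fresh k (vs ! i) v)\<^sup>2" for i] len by simp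
    also have "\<dots> = (\<Sum>b\<in>V. \<Sum>v\<in>V. (fresh k b v)\<^sup>2)"
      using sum_indexed_vertices[OF vs, of "\<lambda>b. \<Sum>v\<in>V. (fresh k b v)\<^sup>2"] len by simp
    finally show ?thesis by simp
  qed
  also have "\<dots> = (\<Sum>i<n. (nb_poly (real d) (es ! i) k)\<^sup>2)"
    by (rule frobenius_nb_poly_mat[OF A sym cp])
  also have "\<dots> = 1 + (\<Sum>i\<in>{1..<n}. (nb_poly (real d) (es ! i) k)\<^sup>2)"
  proof -
    have "{..<n} = insert 0 {1..<n}" using n by auto
    then show ?thesis using es0 d3 by (simp add: nb_poly_degree)
  qed
  also have "\<dots> \<le> 1 + (\<Sum>i\<in>{1..<n}. (C * \<rho> ^ k)\<^sup>2)"
  proof (intro add_left_mono sum_mono)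
    fix i assume "i \<in> {1..<n}"
    from power_mono[OF decay[OF small[OF this], of k] abs_ge_zero, of 2]
    show "(nb_poly (real d) (es ! i) k)\<^sup>2 \<le> (C * \<rho> ^ k)\<^sup>2" by (simp only: power2_abs)
  qed
  also have "\<dots> \<le> 1 + real n * (C * \<rho> ^ k)\<^sup>2" by (simp add: mult_right_mono)
  finally have fr: "(\<Sum>b\<in>V. \<Sum>v\<in>V. (fresh k b v)\<^sup>2) \<le> 1 + real n * (C * \<rho> ^ k)\<^sup>2" .
  \<comment> \<open>Rows sum to 1, so subtracting the uniform matrix lowers the squared Frobenius
    norm by exactly 1.\<close>
  have "(\<Sum>b\<in>V. \<Sum>v\<in>V. (fresh k b v - 1 / real n)\<^sup>2) =
      (\<Sum>b\<in>V. (\<Sum>v\<in>V. (fresh k b v)\<^sup>2) - 2 / real n * (\<Sum>v\<in>V. fresh k b v) + 1 / real n)"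
  proof (intro sum.cong refl)
    fix b
    have "(\<Sum>v\<in>V. (fresh k b v - 1 / real n)\<^sup>2) =
        (\<Sum>v\<in>V. (fresh k b v)\<^sup>2 - 2 / real n * fresh k b v + (1 / real n)\<^sup>2)"
      by (intro sum.cong refl) (simp add: power2_diff)
    also have "\<dots> = (\<Sum>v\<in>V. (fresh k b v)\<^sup>2) - 2 / real n * (\<Sum>v\<in>V. fresh k b v) + 1 / real n"
      using n cV by (simp add: sum.distrib sum_subtractf sum_distrib_left power2_eq_square)
    finally show "(\<Sum>v\<in>V. (fresh k b v - 1 / real n)\<^sup>2) =
        (\<Sum>v\<in>V. (fresh k b v)\<^sup>2) - 2 / real n * (\<Sum>v\<in>V. fresh k b v) + 1 / real n" .
  qed
  also have "\<dots> = (\<Sum>b\<in>V. (\<Sum>v\<in>V. (fresh k b v)\<^sup>2) - 1 / real n)"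
    by (intro sum.cong refl) (simp add: sum_fresh)
  also have "\<dots> = (\<Sum>b\<in>V. \<Sum>v\<in>V. (fresh k b v)\<^sup>2) - 1"
    using n cV by (simp add: sum_subtractf)
  finally have dev: "(\<Sum>b\<in>V. \<Sum>v\<in>V. (fresh k b v - 1 / real n)\<^sup>2) \<le> real n * (C * \<rho> ^ k)\<^sup>2"
    using fr by simp
  have "(fresh k b v - 1 / real n)\<^sup>2 \<le> (\<Sum>v\<in>V. (fresh k b v - 1 / real n)\<^sup>2)"
    using bv pair_finite_verts by (intro member_le_sum) auto
  also have "\<dots> \<le> (\<Sum>b\<in>V. \<Sum>v\<in>V. (fresh k b v - 1 / real n)\<^sup>2)"
    using bv pair_finite_verts by (intro member_le_sum[of b V "\<lambda>b. \<Sum>v\<in>V. (fresh k b v - 1 / real n)\<^sup>2"]) (auto intro: sum_nonneg)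
  also have "\<dots> \<le> real n * (C * \<rho> ^ k)\<^sup>2" by (rule dev)
  \<comment> \<open>Weakening \<open>n\<close> to its square makes the bound a perfect
    square.\<close>
  also have "\<dots> \<le> (real n)\<^sup>2 * (C * \<rho> ^ k)\<^sup>2" using n by (intro mult_right_mono) (auto simp: power2_eq_square)
  finally have "\<bar>fresh k b v - 1 / real n\<bar>\<^sup>2 \<le> (real n * (C * \<rho> ^ k))\<^sup>2"
    by (simp only: power2_abs power_mult_distrib)
  then show ?thesis by (rule power2_le_imp_le) (use Cr in \<open>simp only: mult_nonneg_nonneg of_nat_0_le_iff\<close>)
qed

text \<open>In the induction the previous error returns with weight \<open>1 / m\<close>, where
  \<open>m = d - 1\<close>. The factor 5 is stable because
  \<open>(m + 1) \<rho> + 5 \<le> 5 \<rho> m\<close> for \<open>m \<ge> 2\<close> and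
  \<open>\<rho> \<ge> 3 / 4\<close>.\<close>

lemma hit_mixing:
  assumes fresh: "\<And>b v k. b \<in> V \<Longrightarrow> v \<in> V \<Longrightarrow> \<bar>fresh k b v - 1 / real n\<bar> \<le> real n * (C * \<rho> ^ k)"
    and C: "C \<ge> 1" and \<rho>: "3/4 \<le> \<rho>" and n: "n \<ge> 1"
    and v: "v \<in> V" and e: "e \<in> E"
  shows "\<bar>hit k e v - 1 / real n\<bar> \<le> 5 * (real n * (C * \<rho> ^ k))"
  using e
proof (induction k arbitrary: e)
  case 0
  have "\<bar>hit 0 e v - 1 / real n\<bar> \<le> 1" using n by (auto simp: hit_0)
  also have "1 \<le> real n * C" using mult_mono[of 1 "real n" 1 C] n C by simp
  finally show ?case using C n by simp
next
  case (Suc k)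
  obtain a b where ab: "e = (a, b)" "(a, b) \<in> E" using Suc.prems by (cases e) auto
  define m where "m = real d - 1"
  have m: "m \<ge> 2" "real d = m + 1" using d3 by (auto simp: m_def)
  let ?X = "real n * (C * \<rho> ^ k)"
  have X: "?X \<ge> 0" using C \<rho> by simp
  have "hit (Suc k) e v - 1 / real n =
      ((m + 1) * (fresh (Suc k) b v - 1 / real n) - (hit k (b, a) v - 1 / real n)) / m"
  proof -
    have *: "((m + 1) * F - H) / m - c = ((m + 1) * (F - c) - (H - c)) / m" for F H c
      using m by (simp add: field_simps)
    show ?thesis unfolding ab hit_Suc_fresh[OF ab(2)] m_def[symmetric] unfolding m(2) by (rule *)
  qed
  also have "\<bar>\<dots>\<bar> \<le> ((m + 1) * (\<rho> * ?X) + 5 * ?X) / m"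
  proof -
    have "\<bar>fresh (Suc k) b v - 1 / real n\<bar> \<le> \<rho> * ?X"
      using fresh[of b v "Suc k"] v ab by (auto simp: mult_ac dest: in_arcsD2)
    then have "\<bar>(m + 1) * (fresh (Suc k) b v - 1 / real n)\<bar> \<le> (m + 1) * (\<rho> * ?X)"
      using m by (simp add: abs_mult)
    moreover have "\<bar>hit k (b, a) v - 1 / real n\<bar> \<le> 5 * ?X"
      using ab by (intro Suc.IH) (auto intro: arcs_symmetric)
    ultimately have "\<bar>(m + 1) * (fresh (Suc k) b v - 1 / real n) - (hit k (b, a) v - 1 / real n)\<bar> \<le> (m + 1) * (\<rho> * ?X) + 5 * ?X"
      by linarith
    then show ?thesis using m by (simp add: divide_right_mono)
  qed
  also have "\<dots> \<le> 5 * (\<rho> * ?X)"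
  proof -
    have "(m + 1) * \<rho> + 5 \<le> 5 * \<rho> * m"
    proof -
      have "5 \<le> (4 * m - 1) * (3/4)" using m by simp
      also have "\<dots> \<le> (4 * m - 1) * \<rho>" using m \<rho> by (intro mult_left_mono) auto
      finally show ?thesis by (simp add: algebra_simps)
    qed
    then have "((m + 1) * \<rho> + 5) * ?X \<le> 5 * \<rho> * m * ?X" using X by (rule mult_right_mono)
    then have "(m + 1) * (\<rho> * ?X) + 5 * ?X \<le> 5 * (\<rho> * ?X) * m" by (simp add: algebra_simps)
    then show ?thesis using m by (simp add: pos_divide_le_eq)
  qed
  finally show ?case by (simp add: mult_ac)
qed

text \<open>The errors 5 and 10 combine to \<open>15 / m \<le> 15 / 2 = 10 (3 / 4)\<close>, so the
  factor 10 is stable for \<open>\<rho> \<ge> 3 / 4\<close>.\<close>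

lemma dart_mixing:
  assumes hit: "\<And>k v. v \<in> V \<Longrightarrow> \<bar>hit k e v - 1 / real n\<bar> \<le> 5 * (real n * (C * \<rho> ^ k))"
    and C: "C \<ge> 1" and \<rho>: "3/4 \<le> \<rho>" and n: "n \<ge> 1"
    and e: "e \<in> E" and f: "f \<in> E"
  shows "\<bar>dart k e f - 1 / (real n * real d)\<bar> \<le> 10 * (real n * (C * \<rho> ^ k))"
  using f
proof (induction k arbitrary: f)
  case 0
  have "1 \<le> real n * real d" using mult_mono[of 1 "real n" 1 "real d"] n d3 by simp
  then have "\<bar>dart 0 e f - 1 / (real n * real d)\<bar> \<le> 1" by (auto simp: dart_0)
  moreover have "1 \<le> real n * C" using mult_mono[of 1 "real n" 1 C] n C by simp
  ultimately have "\<bar>dart 0 e f - 1 / (real n * real d)\<bar> \<le> 10 * (real n * C)" by linarith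
  then show ?case by simp
next
  case (Suc k)
  obtain p q where pq: "f = (p, q)" "(p, q) \<in> E" using Suc.prems by (cases f) auto
  define m where "m = real d - 1"
  have m: "m \<ge> 2" "real d = m + 1" using d3 by (auto simp: m_def)
  let ?X = "real n * (C * \<rho> ^ k)"
  have X: "?X \<ge> 0" using C \<rho> by simp
  have "dart (Suc k) e f - 1 / (real n * real d) =
      ((hit k e p - 1 / real n) - (dart k e (q, p) - 1 / (real n * real d))) / m"
  proof -
    have *: "(x - y) / m - c2 = ((x - c1) - (y - c2)) / m" if "c1 - c2 = m * c2" for x y c1 c2
    proof -
      have *: "(x - c1) - (y - c2) = (x - y) - m * c2" using that by simp
      show ?thesis unfolding * using m by (simp add: diff_divide_distrib)
    qed
    have "1 / real n - 1 / (real n * (m + 1)) = m * (1 / (real n * (m + 1)))"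
      using m n by (simp add: divide_simps)
    then show ?thesis unfolding pq dart_Suc[OF e pq(2)] m_def[symmetric] unfolding m(2) by (rule *)
  qed
  also have "\<bar>\<dots>\<bar> \<le> (5 * ?X + 10 * ?X) / m"
  proof -
    have "\<bar>hit k e p - 1 / real n\<bar> \<le> 5 * ?X" using pq by (intro hit) (auto dest: in_arcsD1)
    moreover have "\<bar>dart k e (q, p) - 1 / (real n * real d)\<bar> \<le> 10 * ?X"
      using pq by (intro Suc.IH) (auto intro: arcs_symmetric)
    ultimately have "\<bar>(hit k e p - 1 / real n) - (dart k e (q, p) - 1 / (real n * real d))\<bar> \<le> 5 * ?X + 10 * ?X"
      by (rule order_trans[OF abs_triangle_ineq4 add_mono])
    then show ?thesis using m by (simp add: divide_right_mono)
  qed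
  also have "\<dots> \<le> (5 * ?X + 10 * ?X) / 2" using m C \<rho> by (intro divide_left_mono) auto
  also have "\<dots> = 10 * (3/4 * ?X)" by simp
  also have "\<dots> \<le> 10 * (\<rho> * ?X)" using \<rho> X by (intro mult_left_mono mult_right_mono) auto
  finally show ?case by (simp add: mult_ac)
qed

section \<open>Girth and short returns\<close>

fun nb_list :: "'a list \<Rightarrow> bool" where
  "nb_list (a # b # c # l) \<longleftrightarrow> (a, b) \<in> E \<and> a \<noteq> c \<and> nb_list (b # c # l)"
| "nb_list [a, b] \<longleftrightarrow> (a, b) \<in> E"
| "nb_list _ \<longleftrightarrow> True"

lemma nb_list_nth_arc: "nb_list xs \<Longrightarrow> Suc i < length xs \<Longrightarrow> (xs ! i, xs ! Suc i) \<in> E"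
proof (induction xs arbitrary: i rule: nb_list.induct)
  case (1 a b c l)
  then show ?case by (cases i) auto
qed auto

lemma nb_list_nth_neq: "nb_list xs \<Longrightarrow> Suc (Suc i) < length xs \<Longrightarrow> xs ! i \<noteq> xs ! Suc (Suc i)"
proof (induction xs arbitrary: i rule: nb_list.induct)
  case (1 a b c l)
  then show ?case by (cases i) auto
qed auto

lemma pcas_nth:
  "i \<le> j \<Longrightarrow> pcas (xs ! i) (map (\<lambda>k. (xs ! k, xs ! Suc k)) [i..<j]) (xs ! j)"
proof (induction "j - i" arbitrary: i)
  case (Suc n)
  then have "i < j" by simp
  then show ?case using Suc.hyps(1)[of "Suc i"] Suc.hyps(2) by (simp add: upt_conv_Cons)
qed simp

lemma pawalk_verts_nth:
  "i \<le> j \<Longrightarrow> pawalk_verts (xs ! i) (map (\<lambda>k. (xs ! k, xs ! Suc k)) [i..<j]) = map ((!) xs) [i..<Suc j]"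
proof (induction "j - i" arbitrary: i)
  case (Suc n)
  then have "i < j" by simp
  then have "pawalk_verts (xs ! i) (map (\<lambda>k. (xs ! k, xs ! Suc k)) [i..<j]) = xs ! i # map ((!) xs) [Suc i..<Suc j]"
    using Suc.hyps(1)[of "Suc i"] Suc.hyps(2) by (simp add: upt_conv_Cons del: upt_Suc)
  also have "\<dots> = map ((!) xs) [i..<Suc j]" using \<open>i < j\<close> by (subst (2) upt_conv_Cons) auto
  finally show ?case .
qed simp

text \<open>A closed segment without a shorter closed segment inside repeats no vertex except its
  ends, so it is a cycle. Length 1 would be a loop and length 2 a backtracking step.\<close>

lemma girth_le_closed:
  assumes xs: "nb_list xs" and "i < j" "j < length xs" "xs ! i = xs ! j"
  shows "girth G \<le> enat (j - i)"
  using assms(2-)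
proof (induction "j - i" arbitrary: i j rule: less_induct)
  case less
  show ?case
  proof (cases "\<exists>i' j'. i \<le> i' \<and> i' < j' \<and> j' \<le> j \<and> j' - i' < j - i \<and> xs ! i' = xs ! j'")
    case True
    then obtain i' j' where ij: "i \<le> i'" "i' < j'" "j' \<le> j" "j' - i' < j - i" "xs ! i' = xs ! j'" by blast
    then have "girth G \<le> enat (j' - i')" using less.prems by (intro less.hyps) auto
    also have "\<dots> \<le> enat (j - i)" using ij by simp
    finally show ?thesis .
  next
    case False
    let ?p = "map (\<lambda>k. (xs ! k, xs ! Suc k)) [i..<j]"
    have arcs: "(xs ! k, xs ! Suc k) \<in> E" if "k < j" for k
      using nb_list_nth_arc[OF xs] that less.prems by simp
    have "j - i \<noteq> 1"
    proof
      assume "j - i = 1"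
      then have "j = Suc i" by simp
      then show False using arcs[of i] no_loops'[of "xs ! i"] less.prems by auto
    qed
    moreover have "j - i \<noteq> 2"
    proof
      assume "j - i = 2"
      then have "j = Suc (Suc i)" by simp
      then show False using nb_list_nth_neq[OF xs, of i] less.prems by auto
    qed
    ultimately have len: "length ?p \<ge> 3" using less.prems by simp
    have "xs ! a \<noteq> xs ! b" if "a \<in> {Suc i..j}" "b \<in> {Suc i..j}" "a < b" for a b
      using False that by force
    then have "inj_on ((!) xs) {Suc i..j}"
      by (intro inj_onI) (metis linorder_neqE_nat)
    then have "distinct (tl (pawalk_verts (xs ! i) ?p))"
      using less.prems by (subst pawalk_verts_nth) (auto simp: distinct_map map_tl[symmetric] tl_upt
          atLeastLessThanSuc_atLeastAtMost simp del: upt_Suc)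
    moreover have "awalk (xs ! i) ?p (xs ! i)"
      unfolding awalk_def using arcs pcas_nth[of i j xs] less.prems in_arcsD1[OF arcs[of i]] by auto
    moreover have "?p \<noteq> []" using len by force
    ultimately have "cycle ?p" unfolding cycle_def by blast
    then have "girth G \<le> enat (length ?p)"
      unfolding girth_def using len by (intro INF_lower) auto
    then show ?thesis by simp
  qed
qed

section \<open>Hitting probabilities below half the girth\<close>

lemma hit_nonzero_walk:
  assumes "(a, b) \<in> E" "hit k (a, b) v \<noteq> 0"
  shows "\<exists>l. length l = k \<and> nb_list (a # b # l) \<and> last (b # l) = v"
  using assms
proof (induction k arbitrary: a b)
  case 0
  then show ?case by (auto simp: hit_0)
next
  case (Suc k)
  then have "(\<Sum>c\<in>succs (a, b). hit k (b, c) v) \<noteq> 0" by (auto simp: hit_Suc)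
  then obtain c where c: "c \<in> succs (a, b)" "hit k (b, c) v \<noteq> 0" by (metis (no_types, lifting) sum.neutral)
  then have bc: "(b, c) \<in> E" using succs_arc[of c "(a, b)"] by simp
  from Suc.IH[OF this c(2)] obtain l where l: "length l = k" "nb_list (b # c # l)" "last (c # l) = v" by blast
  have "a \<noteq> c" using c by (auto simp: succs_def)
  then show ?case using l Suc.prems by (intro exI[of _ "c # l"]) auto
qed

text \<open>The first walk is run backwards to \<open>b\<close> and then continued along
  \<open>r\<close>; the second hypothesis holds the non-backtracking condition at the
  junction.\<close>

lemma nb_list_join:
  "nb_list (b # c # l) \<Longrightarrow> nb_list (c # b # r) \<Longrightarrow> nb_list (rev l @ c # b # r)"
proof (induction l arbitrary: b c r)
  case (Cons x l)
  from Cons.prems have "nb_list (c # x # l)" "(x, c) \<in> E" "x \<noteq> b"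
    by (auto intro: arcs_symmetric elim: nb_list.elims split: list.splits)
  then show ?case using Cons.IH[of c x "b # r"] Cons.prems by simp
qed simp

lemma hit_return_zero:
  assumes "(a, v) \<in> E" "1 \<le> k" "enat k < girth G"
  shows "hit k (a, v) v = 0"
proof (rule ccontr)
  assume "hit k (a, v) v \<noteq> 0"
  then obtain l where l: "length l = k" "nb_list (a # v # l)" "last (v # l) = v"
    using hit_nonzero_walk[OF assms(1)] by blast
  have "(a # v # l) ! Suc k = last (v # l)" using l by (subst last_conv_nth) auto
  then have "girth G \<le> enat (Suc k - 1)"
    using l assms by (intro girth_le_closed[OF l(2)]) auto
  then show False using assms(3) by simp
qed

text \<open>Walking back from \<open>v\<close> along one branch and out along the other gives a
  closed non-backtracking walk of length \<open>2 * Suc k\<close>.\<close>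

lemma hit_diverging:
  assumes bc: "(b, c) \<in> E" "hit k (b, c) v \<noteq> 0" and bc': "(b, c') \<in> E" "hit k (b, c') v \<noteq> 0"
    and girth: "enat (2 * Suc k) < girth G"
  shows "c = c'"
proof (rule ccontr)
  assume "c \<noteq> c'"
  obtain l where l: "length l = k" "nb_list (b # c # l)" "last (c # l) = v"
    using hit_nonzero_walk[OF bc] by blast
  obtain l' where l': "length l' = k" "nb_list (b # c' # l')" "last (c' # l') = v"
    using hit_nonzero_walk[OF bc'] by blast
  have "nb_list (c # b # c' # l')" using l' \<open>c \<noteq> c'\<close> arcs_symmetric[OF bc(1)] by simp
  from nb_list_join[OF l(2) this] have w: "nb_list (rev l @ c # b # c' # l')" .
  let ?w = "rev l @ c # b # c' # l'"
  have "?w ! 0 = hd (rev (c # l))" by (cases l rule: rev_cases) auto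
  then have 1: "?w ! 0 = v" using l(3) by (simp only: hd_rev)
  have "last ?w = v" using l' by simp
  then have 2: "?w ! (2 * Suc k) = v" using l l' by (subst (asm) last_conv_nth) (auto simp: mult_2)
  have "girth G \<le> enat (2 * Suc k - 0)"
    using 1 2 l l' by (intro girth_le_closed[OF w]) auto
  then show False using girth by simp
qed

text \<open>By \<open>hit_diverging\<close> at most one successor can still lead to
  \<open>v\<close>, so every step costs a factor \<open>1 / (d - 1)\<close>.\<close>

lemma hit_le_girth:
  assumes "e \<in> E" "enat (2 * k) < girth G"
  shows "hit k e v \<le> 1 / (real d - 1) ^ k"
  using assms
proof (induction k arbitrary: e)
  case 0
  then show ?case by (simp add: hit_0)
next
  case (Suc k)
  have g: "enat (2 * k) < girth G" using Suc.prems(2) by (meson enat_ord_simps(1) le_less_trans mult_le_mono2 lessI less_imp_le)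
  have arc: "(snd e, c) \<in> E" if "c \<in> succs e" for c using succs_arc[OF that] .
  have "(\<Sum>c\<in>succs e. hit k (snd e, c) v) \<le> 1 / (real d - 1) ^ k"
  proof (cases "\<exists>c0\<in>succs e. hit k (snd e, c0) v \<noteq> 0")
    case True
    then obtain c0 where c0: "c0 \<in> succs e" "hit k (snd e, c0) v \<noteq> 0" by blast
    have "hit k (snd e, c) v = 0" if "c \<in> succs e - {c0}" for c
      using hit_diverging[OF arc[OF c0(1)] c0(2) arc _ Suc.prems(2), of c] that by auto
    then have "(\<Sum>c\<in>succs e. hit k (snd e, c) v) = hit k (snd e, c0) v"
      using c0(1) by (simp add: sum.remove)
    then show ?thesis using Suc.IH[OF arc[OF c0(1)] g] by simp
  next
    case False
    then show ?thesis using d_minus_1_pos by (simp add: sum.neutral)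
  qed
  then have "hit (Suc k) e v \<le> 1 / (real d - 1) ^ k / (real d - 1)"
    unfolding hit_Suc using d_minus_1_pos by (intro divide_right_mono) auto
  then show ?case by (simp add: mult.commute)
qed

text \<open>Additional initial steps only average over starting states, so a uniform bound at time
  \<open>r\<close> persists.\<close>

lemma hit_bound_mono:
  assumes "\<And>e. e \<in> E \<Longrightarrow> hit r e v \<le> c" "r \<le> k" "e \<in> E"
  shows "hit k e v \<le> c"
  using assms(2,3)
proof (induction k arbitrary: e rule: dec_induct)
  case (step k)
  have "(\<Sum>c'\<in>succs e. hit k (snd e, c') v) \<le> (\<Sum>c'\<in>succs e. c)"
    by (intro sum_mono step.IH succs_arc)
  also have "\<dots> = (real d - 1) * c" using step.prems by (simp add: real_card_succs)
  finally show ?case using d_minus_1_pos by (simp add: hit_Suc pos_divide_le_eq mult.commute)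
qed (use assms(1) in auto)

section \<open>Upper tail of the number of visits\<close>

definition visit_mgf :: "real \<Rightarrow> nat \<Rightarrow> 'a \<times> 'a \<Rightarrow> 'a \<Rightarrow> real" where
  "visit_mgf \<theta> M e v = wmean M e (\<lambda>l _. \<theta> ^ count_list l v)"

lemma visit_mgf_Suc:
  "visit_mgf \<theta> (Suc M) e v =
    (\<Sum>c\<in>succs e. (if c = v then \<theta> else 1) * visit_mgf \<theta> M (snd e, c) v) / (real d - 1)"
proof -
  have "wmean M (snd e, c) (\<lambda>l _. \<theta> ^ count_list (c # l) v) = (if c = v then \<theta> else 1) * visit_mgf \<theta> M (snd e, c) v" for c
    by (cases "c = v") (simp_all add: visit_mgf_def wmean_cmult)
  then show ?thesis by (simp add: visit_mgf_def)
qed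

text \<open>Decomposition at the visits to \<open>v\<close>: each visit multiplies by \<open>\<theta>\<close> and restarts the walk at \<open>v\<close>.\<close>

lemma visit_mgf_renewal:
  assumes "\<theta> \<ge> 1" and e: "e \<in> E"
    and H: "\<And>j a. j < M \<Longrightarrow> (a, v) \<in> E \<Longrightarrow> visit_mgf \<theta> j (a, v) v \<le> H j"
  shows "visit_mgf \<theta> M e v \<le> 1 + (\<theta> - 1) * (\<Sum>i<M. hit (Suc i) e v * H (M - Suc i))"
  using e H
proof (induction M arbitrary: e)
  case 0
  then show ?case by (simp add: visit_mgf_def)
next
  case (Suc M)
  let ?f = "\<lambda>c. (snd e, c)"
  let ?S = "\<lambda>c. \<Sum>i<Suc M. hit i (?f c) v * H (M - i)"
  have "(if c = v then \<theta> else 1) * visit_mgf \<theta> M (?f c) v \<le> 1 + (\<theta> - 1) * ?S c" if c: "c \<in> succs e" for c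
  proof -
    have arc: "?f c \<in> E" by (rule succs_arc[OF c])
    have IH: "visit_mgf \<theta> M (?f c) v \<le> 1 + (\<theta> - 1) * (\<Sum>i<M. hit (Suc i) (?f c) v * H (M - Suc i))"
      using Suc.prems by (intro Suc.IH[OF arc]) auto
    have "(\<theta> - 1) * (of_bool (c = v) * visit_mgf \<theta> M (?f c) v) \<le> (\<theta> - 1) * (hit 0 (?f c) v * H M)"
      using assms(1) Suc.prems(2)[of M "snd e"] arc by (intro mult_left_mono) (auto simp: hit_0)
    moreover have "(if c = v then \<theta> else 1) * visit_mgf \<theta> M (?f c) v =
        visit_mgf \<theta> M (?f c) v + (\<theta> - 1) * (of_bool (c = v) * visit_mgf \<theta> M (?f c) v)"
      by (auto simp: algebra_simps)
    moreover have "?S c = hit 0 (?f c) v * H M + (\<Sum>i<M. hit (Suc i) (?f c) v * H (M - Suc i))"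
      by (subst sum.lessThan_Suc_shift) simp
    ultimately show ?thesis using IH by (simp add: distrib_left)
  qed
  then have "visit_mgf \<theta> (Suc M) e v \<le> (\<Sum>c\<in>succs e. 1 + (\<theta> - 1) * ?S c) / (real d - 1)"
    unfolding visit_mgf_Suc using d_minus_1_pos by (intro divide_right_mono sum_mono) auto
  also have "\<dots> = 1 + (\<theta> - 1) * ((\<Sum>c\<in>succs e. ?S c) / (real d - 1))"
    using d_minus_1_pos Suc.prems(1)
    by (simp add: sum.distrib real_card_succs add_divide_distrib sum_distrib_left[symmetric] del: sum.lessThan_Suc)
  also have "(\<Sum>c\<in>succs e. ?S c) / (real d - 1) = (\<Sum>i<Suc M. hit (Suc i) e v * H (Suc M - Suc i))"
    unfolding hit_Suc by (subst sum.swap) (simp add: sum_divide_distrib sum_distrib_right del: sum.lessThan_Suc)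
  finally show ?case .
qed

lemma sum_powers_reversed:
  assumes "s \<noteq> (0::real)"
  shows "(\<Sum>i<M. (1 + s) ^ (M - Suc i)) = ((1 + s) ^ M - 1) / s"
proof -
  have "(\<Sum>i<M. (1 + s) ^ (M - Suc i)) = (\<Sum>i<M. (1 + s) ^ i)"
    by (rule sum.nat_diff_reindex)
  also have "\<dots> = ((1 + s) ^ M - 1) / s"
    using assms geometric_sum[of "1 + s" M] by simp
  finally show ?thesis .
qed

text \<open>The renewal sum for the ansatz \<open>H j = 2 (1 + s)^j\<close>. Early terms receive the
  full power and are governed by the expected early visits; late terms form a geometric
  series.\<close>

lemma renewal_sum_bound:
  assumes late: "\<And>i. K \<le> i \<Longrightarrow> hit (Suc i) e v \<le> c" and c: "0 \<le> c" and s: "s > 0"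
  shows "(\<Sum>i<M. hit (Suc i) e v * (2 * (1 + s) ^ (M - Suc i)))
    \<le> 2 * (1 + s) ^ M * (\<Sum>i<K. hit (Suc i) e v) + 2 * c * (((1 + s) ^ M - 1) / s)"
proof -
  have "(\<Sum>i<M. hit (Suc i) e v * (2 * (1 + s) ^ (M - Suc i))) \<le>
      (\<Sum>i<M. (if i < K then hit (Suc i) e v else 0) * (2 * (1 + s) ^ M) + 2 * c * (1 + s) ^ (M - Suc i))"
  proof (rule sum_mono)
    fix i assume "i \<in> {..<M}"
    have p: "(1 + s) ^ (M - Suc i) \<le> (1 + s) ^ M" using s by (intro power_increasing) auto
    have p0: "0 \<le> (1 + s) ^ (M - Suc i)" using s by simp
    show "hit (Suc i) e v * (2 * (1 + s) ^ (M - Suc i)) \<le>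
      (if i < K then hit (Suc i) e v else 0) * (2 * (1 + s) ^ M) + 2 * c * (1 + s) ^ (M - Suc i)"
    proof (cases "i < K")
      case True
      have "hit (Suc i) e v * (2 * (1 + s) ^ (M - Suc i)) \<le> hit (Suc i) e v * (2 * (1 + s) ^ M)"
        using p hit_nonneg by (intro mult_left_mono) auto
      moreover have "0 \<le> 2 * c * (1 + s) ^ (M - Suc i)" using c p0 by simp
      ultimately show ?thesis unfolding if_P[OF True] by linarith
    next
      case False
      then have "hit (Suc i) e v \<le> c" by (intro late) simp
      then have "hit (Suc i) e v * (2 * (1 + s) ^ (M - Suc i)) \<le> c * (2 * (1 + s) ^ (M - Suc i))"
        using p0 by (intro mult_right_mono) auto
      then show ?thesis using False by simp
    qed
  qed
  also have "\<dots> = 2 * (1 + s) ^ M * (\<Sum>i<M. if i < K then hit (Suc i) e v else 0) + 2 * c * (\<Sum>i<M. (1 + s) ^ (M - Suc i))"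
    by (simp add: sum.distrib sum_distrib_left sum_distrib_right mult_ac)
  also have "(\<Sum>i<M. if i < K then hit (Suc i) e v else 0) = (\<Sum>i\<in>{i\<in>{..<M}. i < K}. hit (Suc i) e v)"
    by (rule sum.inter_filter[symmetric]) simp
  also have "2 * (1 + s) ^ M * \<dots> \<le> 2 * (1 + s) ^ M * (\<Sum>i<K. hit (Suc i) e v)"
    using s hit_nonneg by (intro mult_left_mono sum_mono2) auto
  finally show ?thesis using s by (simp add: sum_powers_reversed)
qed

text \<open>The renewal inequality is bootstrapped. With \<open>s = 8 \<theta> / n\<close> and
  \<open>X = (1 + s)^M\<close>, early visits contribute at most \<open>X / 2\<close> and late ones
  at most \<open>(X - 1) / 2\<close>, so the bound \<open>2 X\<close> reproduces itself.\<close>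

lemma visit_mgf_at_vertex:
  assumes \<theta>: "\<theta> \<ge> 1" and n: "n > 0"
    and early: "\<And>a. (a, v) \<in> E \<Longrightarrow> (\<theta> - 1) * (\<Sum>i<K. hit (Suc i) (a, v) v) \<le> 1 / 4"
    and late: "\<And>e i. e \<in> E \<Longrightarrow> K \<le> i \<Longrightarrow> hit (Suc i) e v \<le> 2 / real n"
    and a: "(a, v) \<in> E"
  shows "visit_mgf \<theta> M (a, v) v \<le> 2 * (1 + 8 * \<theta> / real n) ^ M"
  using a
proof (induction M arbitrary: a rule: less_induct)
  case (less M)
  define s where "s = 8 * \<theta> / real n"
  have s: "s > 0" using \<theta> n by (simp add: s_def)
  define X where "X = (1 + s) ^ M"
  have X: "X \<ge> 1" using s by (simp add: X_def)
  have "visit_mgf \<theta> M (a, v) v \<le> 1 + (\<theta> - 1) * (\<Sum>i<M. hit (Suc i) (a, v) v * (2 * (1 + s) ^ (M - Suc i)))"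
    using less unfolding s_def by (intro visit_mgf_renewal \<theta>) auto
  also have "\<dots> \<le> 1 + (\<theta> - 1) * (2 * X * (\<Sum>i<K. hit (Suc i) (a, v) v) + 2 * (2 / real n) * ((X - 1) / s))"
    unfolding X_def using \<theta> s late[OF less.prems] by (intro add_left_mono mult_left_mono renewal_sum_bound) auto
  also have "\<dots> = 1 + 2 * X * ((\<theta> - 1) * (\<Sum>i<K. hit (Suc i) (a, v) v)) + (\<theta> - 1) / (2 * \<theta>) * (X - 1)"
    using \<theta> n by (simp add: s_def field_simps)
  also have "\<dots> \<le> 1 + 2 * X * (1 / 4) + 1 / 2 * (X - 1)"
    using X \<theta> by (intro add_mono mult_left_mono mult_right_mono early less.prems order_refl) auto
  also have "\<dots> = X + 1 / 2" by (simp add: field_simps)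
  also have "\<dots> \<le> 2 * X" using X by simp
  finally show ?case by (simp add: X_def s_def)
qed

text \<open>From an arbitrary state a first visit may come early, so the expected early visits are
  bounded trivially by \<open>K\<close>; this costs only the prefactor. The exponential is
  \<open>(1 + 8 \<theta> / n)^M\<close> with \<open>M \<le> n\<close>.\<close>

lemma visit_mgf_bound:
  assumes \<theta>: "\<theta> \<ge> 1" and n: "n > 0" and M: "M \<le> n"
    and early: "\<And>a. (a, v) \<in> E \<Longrightarrow> (\<theta> - 1) * (\<Sum>i<K. hit (Suc i) (a, v) v) \<le> 1 / 4"
    and late: "\<And>e i. e \<in> E \<Longrightarrow> K \<le> i \<Longrightarrow> hit (Suc i) e v \<le> 2 / real n"
    and e: "e \<in> E"
  shows "visit_mgf \<theta> M e v \<le> (2 + 2 * \<theta> * real K) * exp (8 * \<theta>)"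
proof -
  define s where "s = 8 * \<theta> / real n"
  have s: "s > 0" using \<theta> n by (simp add: s_def)
  define X where "X = (1 + s) ^ M"
  have X: "X \<ge> 1" using s by (simp add: X_def)
  have "X \<le> exp s ^ M" unfolding X_def using s by (intro power_mono) auto
  also have "\<dots> = exp (s * real M)" by (simp add: exp_of_nat_mult[symmetric] mult.commute)
  also have "s * real M \<le> s * real n" using s M by simp
  also have "s * real n = 8 * \<theta>" using n by (simp add: s_def)
  finally have XE: "X \<le> exp (8 * \<theta>)" by simp
  have "(\<Sum>i<K. hit (Suc i) e v) \<le> (\<Sum>i<K. 1)" by (intro sum_mono hit_le_1 e)
  then have K: "(\<Sum>i<K. hit (Suc i) e v) \<le> real K" by simp
  have S: "0 \<le> (\<Sum>i<K. hit (Suc i) e v)" by (intro sum_nonneg hit_nonneg)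
  have "visit_mgf \<theta> M e v \<le> 1 + (\<theta> - 1) * (\<Sum>i<M. hit (Suc i) e v * (2 * (1 + s) ^ (M - Suc i)))"
    unfolding s_def using early late n by (intro visit_mgf_renewal[OF \<theta> e] visit_mgf_at_vertex[OF \<theta> n]) auto
  also have "\<dots> \<le> 1 + (\<theta> - 1) * (2 * X * (\<Sum>i<K. hit (Suc i) e v) + 2 * (2 / real n) * ((X - 1) / s))"
    unfolding X_def using \<theta> s late[OF e] by (intro add_left_mono mult_left_mono renewal_sum_bound) auto
  also have "\<dots> = 1 + 2 * X * ((\<theta> - 1) * (\<Sum>i<K. hit (Suc i) e v)) + (\<theta> - 1) / (2 * \<theta>) * (X - 1)"
    using \<theta> n by (simp add: s_def field_simps)
  also have "\<dots> \<le> 1 + 2 * X * (\<theta> * real K) + 1 * (X - 1)"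
    using X \<theta> K S by (intro add_mono mult_left_mono mult_right_mono mult_mono order_refl) auto
  also have "\<dots> \<le> (2 + 2 * \<theta> * real K) * X" using X by (simp add: algebra_simps)
  also have "\<dots> \<le> (2 + 2 * \<theta> * real K) * exp (8 * \<theta>)" using XE \<theta> by (intro mult_left_mono) auto
  finally show ?thesis .
qed

text \<open>Markov's inequality at each vertex and a union bound over all \<open>n\<close>
  vertices.\<close>

lemma visits_upper_tail:
  assumes \<theta>: "\<theta> \<ge> 1" and n: "n > 0" and M: "M \<le> n"
    and early: "\<And>a v. (a, v) \<in> E \<Longrightarrow> (\<theta> - 1) * (\<Sum>i<K. hit (Suc i) (a, v) v) \<le> 1 / 4"
    and late: "\<And>e v i. e \<in> E \<Longrightarrow> v \<in> V \<Longrightarrow> K \<le> i \<Longrightarrow> hit (Suc i) e v \<le> 2 / real n"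
    and e: "e \<in> E" and cV: "card V = n"
  shows "wmean M e (\<lambda>l _. of_bool (\<exists>v\<in>V. t \<le> real (count_list l v)))
    \<le> real n * ((2 + 2 * \<theta> * real K) * exp (8 * \<theta>) * \<theta> powr (- t))"
proof -
  have "wmean M e (\<lambda>l _. of_bool (\<exists>v\<in>V. t \<le> real (count_list l v))) \<le>
      wmean M e (\<lambda>l _. \<Sum>v\<in>V. \<theta> powr (- t) * \<theta> ^ count_list l v)"
  proof (intro wmean_mono e)
    fix l :: "'a list"
    show "of_bool (\<exists>v\<in>V. t \<le> real (count_list l v)) \<le> (\<Sum>v\<in>V. \<theta> powr (- t) * \<theta> ^ count_list l v)"
    proof (cases "\<exists>v\<in>V. t \<le> real (count_list l v)")
      case True
      then obtain v where v: "v \<in> V" "t \<le> real (count_list l v)" by force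
      have "1 = \<theta> powr 0" using \<theta> by simp
      also have "\<dots> \<le> \<theta> powr (- t + real (count_list l v))" using v \<theta> by (intro powr_mono) auto
      also have "\<dots> = \<theta> powr (- t) * \<theta> ^ count_list l v"
        using powr_realpow[of \<theta> "count_list l v"] \<theta> by (simp only: powr_add)
      also have "\<dots> \<le> (\<Sum>v\<in>V. \<theta> powr (- t) * \<theta> ^ count_list l v)"
        using v \<theta> pair_finite_verts by (intro member_le_sum) auto
      finally show ?thesis using True by simp
    next
      case False
      then show ?thesis using \<theta> by (simp add: sum_nonneg)
    qed
  qed
  also have "\<dots> = (\<Sum>v\<in>V. \<theta> powr (- t) * visit_mgf \<theta> M e v)"
    unfolding visit_mgf_def wmean_sum[OF pair_finite_verts] wmean_cmult ..
  also have "\<dots> \<le> (\<Sum>v\<in>V. \<theta> powr (- t) * ((2 + 2 * \<theta> * real K) * exp (8 * \<theta>)))"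
    by (intro sum_mono mult_left_mono visit_mgf_bound[OF \<theta> n M early late e]) auto
  also have "\<dots> = real n * ((2 + 2 * \<theta> * real K) * exp (8 * \<theta>) * \<theta> powr (- t))"
    by (simp add: cV mult_ac)
  finally show ?thesis .
qed

end

section \<open>Variance of self-bounding functions of independent blocks\<close>

text \<open>Expectation as a positive normalised linear functional: averages of \<open>wmean\<close>
  are direct instances, and independence becomes iteration. \<open>\<Omega>\<close> acts as a
  support, off which signs do not matter.\<close>

locale mean_functional =
  fixes \<Omega> :: "'x set" and T :: "('x \<Rightarrow> real) \<Rightarrow> real"
  assumes add: "T (\<lambda>x. f x + g x) = T f + T g"
    and cmult: "T (\<lambda>x. c * f x) = c * T f"
    and nonneg: "(\<And>x. x \<in> \<Omega> \<Longrightarrow> 0 \<le> f x) \<Longrightarrow> 0 \<le> T f"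
    and one: "T (\<lambda>_. 1) = 1"
begin

lemma const: "T (\<lambda>_. c) = c"
  using cmult[of c "\<lambda>_. 1"] one by simp

lemma diff: "T (\<lambda>x. f x - g x) = T f - T g"
  using add[of f "\<lambda>x. - 1 * g x"] cmult[of "- 1" g] by simp

lemma mono: "(\<And>x. x \<in> \<Omega> \<Longrightarrow> f x \<le> g x) \<Longrightarrow> T f \<le> T g"
  using nonneg[of "\<lambda>x. g x - f x"] by (simp add: diff)

lemma cong: "(\<And>x. x \<in> \<Omega> \<Longrightarrow> f x = g x) \<Longrightarrow> T f = T g"
  by (intro antisym mono) auto

lemma sum: "finite A \<Longrightarrow> T (\<lambda>x. \<Sum>a\<in>A. f a x) = (\<Sum>a\<in>A. T (f a))"
  by (induction A rule: finite_induct) (auto simp: add const)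

lemma square_deviation: "T (\<lambda>x. (f x - c)\<^sup>2) = T (\<lambda>x. (f x)\<^sup>2) - (T f)\<^sup>2 + (T f - c)\<^sup>2"
proof -
  have "T (\<lambda>x. (f x - c)\<^sup>2) = T (\<lambda>x. (f x)\<^sup>2 + ((- 2 * c) * f x + c\<^sup>2))"
    by (intro cong) (simp add: power2_diff)
  also have "\<dots> = T (\<lambda>x. (f x)\<^sup>2) + ((- 2 * c) * T f + c\<^sup>2)"
    by (simp only: add cmult const)
  finally show ?thesis by (simp add: power2_diff)
qed

lemma square_le: "(T f)\<^sup>2 \<le> T (\<lambda>x. (f x)\<^sup>2)"
  using square_deviation[of f "T f"] nonneg[of "\<lambda>x. (f x - T f)\<^sup>2"] by simp

text \<open>The product law of \<open>M\<close> independent copies, with the head of the list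
  integrated innermost.\<close>

primrec iter :: "nat \<Rightarrow> ('x list \<Rightarrow> real) \<Rightarrow> real" where
  "iter 0 F = F []"
| "iter (Suc M) F = iter M (\<lambda>xs. T (\<lambda>x. F (x # xs)))"

lemma mean_functional_iter: "mean_functional {xs. length xs = M \<and> set xs \<subseteq> \<Omega>} (iter M)"
proof (induction M)
  case 0
  show ?case by unfold_locales auto
next
  case (Suc M)
  interpret I: mean_functional "{xs. length xs = M \<and> set xs \<subseteq> \<Omega>}" "iter M" by fact
  show ?case
  proof
    fix f :: "'x list \<Rightarrow> real"
    assume f: "\<And>xs. xs \<in> {xs. length xs = Suc M \<and> set xs \<subseteq> \<Omega>} \<Longrightarrow> 0 \<le> f xs"
    show "0 \<le> iter (Suc M) f"
      unfolding iter.simps by (intro I.nonneg nonneg f) auto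
  qed (simp_all add: add cmult one I.add I.cmult I.one)
qed

lemmas iter_add = mean_functional.add[OF mean_functional_iter]
  and iter_cmult = mean_functional.cmult[OF mean_functional_iter]
  and iter_diff = mean_functional.diff[OF mean_functional_iter]
  and iter_mono = mean_functional.mono[OF mean_functional_iter]
  and iter_cong = mean_functional.cong[OF mean_functional_iter]
  and iter_sum = mean_functional.sum[OF mean_functional_iter]
  and iter_square_deviation = mean_functional.square_deviation[OF mean_functional_iter]

text \<open>The deletion form: \<open>F\<close> on the list without entry \<open>j\<close> is a
  function of the other coordinates only. This is why \<open>F\<close> lives on lists of every
  length.\<close>

lemma efron_stein:
  "iter M (\<lambda>xs. (F xs)\<^sup>2) - (iter M F)\<^sup>2
    \<le> (\<Sum>j<M. iter M (\<lambda>xs. (F xs - F (take j xs @ drop (Suc j) xs))\<^sup>2))"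
proof (induction M arbitrary: F)
  case 0
  then show ?case by simp
next
  case (Suc M)
  define F' where "F' = (\<lambda>xs. T (\<lambda>x. F (x # xs)))"
  have "iter (Suc M) (\<lambda>xs. (F xs)\<^sup>2) - (iter (Suc M) F)\<^sup>2 =
      iter M (\<lambda>xs. T (\<lambda>x. (F (x # xs))\<^sup>2) - (F' xs)\<^sup>2) + (iter M (\<lambda>xs. (F' xs)\<^sup>2) - (iter M F')\<^sup>2)"
    by (simp add: iter_diff F'_def)
  \<comment> \<open>The variance in the head coordinate is at most the mean squared deviation from
    \<open>F xs\<close>, which is constant in the head; Jensen moves the differences of means inside
    \<open>T\<close>.\<close>
  also have "\<dots> \<le> iter M (\<lambda>xs. T (\<lambda>x. (F (x # xs) - F xs)\<^sup>2)) +
      (\<Sum>j<M. iter M (\<lambda>xs. T (\<lambda>x. (F (x # xs) - F (x # take j xs @ drop (Suc j) xs))\<^sup>2)))"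
  proof (intro add_mono order_trans[OF Suc.IH] sum_mono iter_mono)
    fix xs
    show "T (\<lambda>x. (F (x # xs))\<^sup>2) - (F' xs)\<^sup>2 \<le> T (\<lambda>x. (F (x # xs) - F xs)\<^sup>2)"
      unfolding square_deviation F'_def by simp
  next
    fix j xs
    show "(F' xs - F' (take j xs @ drop (Suc j) xs))\<^sup>2 \<le>
        T (\<lambda>x. (F (x # xs) - F (x # take j xs @ drop (Suc j) xs))\<^sup>2)"
      unfolding F'_def diff[symmetric] by (rule square_le)
  qed
  also have "\<dots> = (\<Sum>j<Suc M. iter (Suc M) (\<lambda>xs. (F xs - F (take j xs @ drop (Suc j) xs))\<^sup>2))"
    by (subst sum.lessThan_Suc_shift) simp
  finally show ?case .
qed

lemma chebyshev_zero:
  assumes "iter M F > 0"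
  shows "iter M (\<lambda>xs. of_bool (F xs = 0)) \<le> (iter M (\<lambda>xs. (F xs)\<^sup>2) - (iter M F)\<^sup>2) / (iter M F)\<^sup>2"
proof -
  let ?m = "iter M F"
  have "iter M (\<lambda>xs. of_bool (F xs = 0)) \<le> iter M (\<lambda>xs. 1 / ?m\<^sup>2 * (F xs - ?m)\<^sup>2)"
    by (intro iter_mono) (use assms in auto)
  also have "\<dots> = (iter M (\<lambda>xs. (F xs)\<^sup>2) - ?m\<^sup>2) / ?m\<^sup>2"
    unfolding iter_cmult iter_square_deviation by simp
  finally show ?thesis .
qed

end

section \<open>Vertices occurring in many blocks\<close>

text \<open>Repeated visits inside a block count once: the count is then binomial for independent
  blocks and stays below the number of visits.\<close>

definition occ :: "'a \<Rightarrow> 'a list list \<Rightarrow> nat" where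
  "occ v xs = length (filter (\<lambda>x. v \<in> set x) xs)"

lemma occ_Nil [simp]: "occ v [] = 0"
  and occ_Cons: "occ v (x # xs) = of_bool (v \<in> set x) + occ v xs"
  and occ_append: "occ v (xs @ ys) = occ v xs + occ v ys"
  by (auto simp: occ_def)

lemma occ_remove:
  assumes "j < length xs"
  shows "occ v xs = of_bool (v \<in> set (xs ! j)) + occ v (take j xs @ drop (Suc j) xs)"
proof -
  have "occ v xs = occ v (take j xs @ xs ! j # drop (Suc j) xs)"
    using assms by (simp add: id_take_nth_drop[symmetric])
  then show ?thesis by (simp add: occ_append occ_Cons)
qed

lemma occ_sum: "real (occ v xs) = (\<Sum>j<length xs. of_bool (v \<in> set (xs ! j)))"
  by (induction xs) (simp_all add: occ_Cons sum.lessThan_Suc_shift del: sum.lessThan_Suc)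

definition heavy :: "'a set \<Rightarrow> nat \<Rightarrow> 'a list list \<Rightarrow> real" where
  "heavy V t xs = (\<Sum>v\<in>V. of_bool (t \<le> occ v xs))"

text \<open>Removing a block only affects the vertices of that block that occur exactly \<open>t\<close> times.\<close>

lemma heavy_self_bounding:
  assumes V: "finite V" and len: "\<And>x. x \<in> set xs \<Longrightarrow> length x \<le> B"
  shows "(\<Sum>j<length xs. (heavy V t xs - heavy V t (take j xs @ drop (Suc j) xs))\<^sup>2)
    \<le> real B * real t * heavy V t xs"
proof -
  define D where "D j = (\<Sum>v\<in>V. of_bool (occ v xs = t) * of_bool (v \<in> set (xs ! j)) :: real)" for j
  have D: "heavy V t xs - heavy V t (take j xs @ drop (Suc j) xs) = D j" if "j < length xs" for j
    unfolding heavy_def D_def sum_subtractf[symmetric]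
    by (intro sum.cong refl) (auto simp: occ_remove[OF that])
  have D0: "0 \<le> D j" for j by (auto simp: D_def intro: sum_nonneg)
  have DB: "D j \<le> real B" if "j < length xs" for j
  proof -
    have "D j \<le> (\<Sum>v\<in>V. if v \<in> set (xs ! j) then 1 else 0)"
      unfolding D_def by (intro sum_mono) auto
    also have "\<dots> = real (card {v \<in> V. v \<in> set (xs ! j)})"
      using V by (simp add: sum.inter_filter[symmetric])
    also have "\<dots> \<le> real (card (set (xs ! j)))"
      by (intro of_nat_mono card_mono) auto
    also have "\<dots> \<le> real B"
      using len[of "xs ! j"] card_length[of "xs ! j"] that by simp
    finally show ?thesis .
  qed
  \<comment> \<open>\<open>D j \<le> B\<close> makes the square linear in
    \<open>D j\<close>.\<close>
  have "(\<Sum>j<length xs. (heavy V t xs - heavy V t (take j xs @ drop (Suc j) xs))\<^sup>2) \<le> (\<Sum>j<length xs. real B * D j)"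
    using D0 DB by (intro sum_mono) (auto simp: D power2_eq_square intro!: mult_right_mono)
  \<comment> \<open>Summing over the blocks counts a vertex with exactly \<open>t\<close>
    occurrences \<open>t\<close> times.\<close>
  also have "\<dots> = real B * (\<Sum>v\<in>V. of_bool (occ v xs = t) * real (occ v xs))"
    unfolding D_def occ_sum sum_distrib_left by (subst sum.swap) simp
  also have "\<dots> \<le> real B * (\<Sum>v\<in>V. real t * of_bool (t \<le> occ v xs))"
    by (intro mult_left_mono sum_mono) auto
  also have "\<dots> = real B * real t * heavy V t xs"
    by (simp add: heavy_def sum_distrib_left mult.assoc)
  finally show ?thesis .
qed

locale block_mean = mean_functional \<Omega> T for \<Omega> :: "'a list set" and T +
  fixes V :: "'a set" and B :: nat
  assumes finite_V: "finite V" and block_length: "x \<in> \<Omega> \<Longrightarrow> length x = B"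
begin

lemma occ_binomial:
  assumes q: "q = T (\<lambda>x. of_bool (v \<in> set x))"
  shows "iter M (\<lambda>xs. of_bool (occ v xs = t)) = real (M choose t) * q ^ t * (1 - q) ^ (M - t)"
proof (induction M arbitrary: t)
  case 0
  then show ?case by (cases t) auto
next
  case (Suc M)
  have q': "T (\<lambda>x. 1 - of_bool (v \<in> set x)) = 1 - q" by (simp add: diff one q)
  show ?case
  proof (cases t)
    case 0
    have "T (\<lambda>x. of_bool (occ v (x # xs) = t)) = (1 - q) * of_bool (occ v xs = 0)" for xs
    proof -
      have "T (\<lambda>x. of_bool (occ v (x # xs) = t)) = T (\<lambda>x. of_bool (occ v xs = 0) * (1 - of_bool (v \<in> set x)))"
        by (intro cong) (auto simp: occ_Cons 0)
      then show ?thesis by (simp add: cmult q')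
    qed
    then show ?thesis using Suc.IH[of 0] by (simp add: 0 iter_cmult)
  next
    case (Suc s)
    have "T (\<lambda>x. of_bool (occ v (x # xs) = t)) = q * of_bool (occ v xs = s) + (1 - q) * of_bool (occ v xs = t)" for xs
    proof -
      have "T (\<lambda>x. of_bool (occ v (x # xs) = t)) =
          T (\<lambda>x. of_bool (occ v xs = s) * of_bool (v \<in> set x) + of_bool (occ v xs = t) * (1 - of_bool (v \<in> set x)))"
        by (intro cong) (auto simp: occ_Cons Suc)
      then show ?thesis by (simp add: add cmult q' q)
    qed
    then have "iter (Suc M) (\<lambda>xs. of_bool (occ v xs = t)) =
        q * (real (M choose s) * q ^ s * (1 - q) ^ (M - s)) + (1 - q) * (real (M choose t) * q ^ t * (1 - q) ^ (M - t))"
      by (simp add: iter_add iter_cmult Suc.IH)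
    \<comment> \<open>For \<open>t > M\<close> both sides vanish with the binomial coefficient;
      otherwise the natural subtraction is exact.\<close>
    also have "(1 - q) * (real (M choose t) * q ^ t * (1 - q) ^ (M - t)) = real (M choose t) * q ^ t * (1 - q) ^ (M - s)"
    proof (cases "t \<le> M")
      case True
      then have "M - s = Suc (M - t)" using Suc by simp
      then show ?thesis by simp
    qed simp
    also have "q * (real (M choose s) * q ^ s * (1 - q) ^ (M - s)) + real (M choose t) * q ^ t * (1 - q) ^ (M - s) =
        real (Suc M choose t) * q ^ t * (1 - q) ^ (Suc M - t)"
      by (simp add: Suc algebra_simps)
    finally show ?thesis .
  qed
qed

text \<open>Only the event of exactly \<open>t\<close> occurrences is kept. The binomial coefficient
  is at least \<open>(M / t)^t\<close>, and Bernoulli gives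
  \<open>(1 - q)^(M - t) \<ge> 1 - M q \<ge> 1 / 2\<close>.\<close>

lemma occ_lower_tail:
  assumes q: "q0 \<le> T (\<lambda>x. of_bool (v \<in> set x))" "T (\<lambda>x. of_bool (v \<in> set x)) \<le> q1"
    and q0: "0 \<le> q0" and Mq: "real M * q1 \<le> 1 / 2" and t: "1 \<le> t" "t \<le> M"
  shows "iter M (\<lambda>xs. of_bool (t \<le> occ v xs)) \<ge> (real M * q0 / real t) ^ t / 2"
proof -
  define q where "q = T (\<lambda>x. of_bool (v \<in> set x))"
  have q01: "0 \<le> q" "q \<le> 1" unfolding q_def
    using nonneg[of "\<lambda>x. of_bool (v \<in> set x)"] mono[of "\<lambda>x. of_bool (v \<in> set x)" "\<lambda>_. 1"] one by auto
  have "(real M * q0 / real t) ^ t / 2 = (real M / real t) ^ t * q0 ^ t * (1 / 2)"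
    by (simp add: power_mult_distrib power_divide)
  also have "\<dots> \<le> real (M choose t) * q ^ t * (1 - q) ^ (M - t)"
  proof (intro mult_mono)
    show "(real M / real t) ^ t \<le> real (M choose t)"
      using t by (intro binomial_ge_n_over_k_pow_k)
    show "q0 ^ t \<le> q ^ t" using q q0 by (intro power_mono) (auto simp: q_def)
    have "1 / 2 \<le> 1 + real M * (- q)"
      using q Mq mult_left_mono[OF q(2), of "real M"] by (simp add: q_def)
    also have "\<dots> \<le> (1 + (- q)) ^ M" using q01 by (intro Bernoulli_inequality) simp
    also have "\<dots> \<le> (1 - q) ^ (M - t)" using q01 by (simp add: power_decreasing)
    finally show "1 / 2 \<le> (1 - q) ^ (M - t)" .
  qed (use q01 q0 in auto)
  also have "\<dots> = iter M (\<lambda>xs. of_bool (occ v xs = t))" by (rule occ_binomial[OF q_def, symmetric])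
  also have "\<dots> \<le> iter M (\<lambda>xs. of_bool (t \<le> occ v xs))" by (intro iter_mono) auto
  finally show ?thesis .
qed

text \<open>As the variance is at most \<open>B t\<close> times the mean, Chebyshev bounds the
  probability by \<open>B t\<close> divided by the mean.\<close>

lemma no_heavy_vertex:
  assumes q: "\<And>v. v \<in> V \<Longrightarrow> q0 \<le> T (\<lambda>x. of_bool (v \<in> set x))"
      "\<And>v. v \<in> V \<Longrightarrow> T (\<lambda>x. of_bool (v \<in> set x)) \<le> q1"
    and q0: "0 < q0" and Mq: "real M * q1 \<le> 1 / 2" and t: "1 \<le> t" "t \<le> M" and V: "V \<noteq> {}"
  shows "iter M (\<lambda>xs. of_bool (\<forall>v\<in>V. occ v xs < t))
    \<le> 2 * real B * real t * (real t / (real M * q0)) ^ t / real (card V)"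
proof -
  let ?m = "iter M (heavy V t)" and ?a = "(real M * q0 / real t) ^ t / 2"
  have M: "real M > 0" using t by simp
  have a: "?a > 0" using M q0 t by simp
  have card: "real (card V) > 0" using V finite_V by (simp add: card_gt_0_iff)
  have "?m = (\<Sum>v\<in>V. iter M (\<lambda>xs. of_bool (t \<le> occ v xs)))"
    unfolding heavy_def by (rule iter_sum[OF finite_V])
  also have "\<dots> \<ge> (\<Sum>v\<in>V. ?a)"
    by (intro sum_mono occ_lower_tail[where ?q1.0 = q1] q Mq t less_imp_le[OF q0])
  finally have m: "?m \<ge> real (card V) * ?a" by simp
  then have m0: "?m > 0" using a card by (meson less_le_trans mult_pos_pos)
  have "iter M (\<lambda>xs. (heavy V t xs)\<^sup>2) - ?m\<^sup>2
      \<le> (\<Sum>j<M. iter M (\<lambda>xs. (heavy V t xs - heavy V t (take j xs @ drop (Suc j) xs))\<^sup>2))"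
    by (rule efron_stein)
  also have "\<dots> = iter M (\<lambda>xs. \<Sum>j<M. (heavy V t xs - heavy V t (take j xs @ drop (Suc j) xs))\<^sup>2)"
    by (rule iter_sum[symmetric]) simp
  also have "\<dots> \<le> iter M (\<lambda>xs. real B * real t * heavy V t xs)"
  proof (intro iter_mono)
    fix xs assume "xs \<in> {xs. length xs = M \<and> set xs \<subseteq> \<Omega>}"
    then show "(\<Sum>j<M. (heavy V t xs - heavy V t (take j xs @ drop (Suc j) xs))\<^sup>2) \<le> real B * real t * heavy V t xs"
      using heavy_self_bounding[OF finite_V, of xs B t] block_length by force
  qed
  also have "\<dots> = real B * real t * ?m" by (rule iter_cmult)
  finally have var: "iter M (\<lambda>xs. (heavy V t xs)\<^sup>2) - ?m\<^sup>2 \<le> real B * real t * ?m" .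
  have "iter M (\<lambda>xs. of_bool (\<forall>v\<in>V. occ v xs < t)) = iter M (\<lambda>xs. of_bool (heavy V t xs = 0))"
    unfolding heavy_def using finite_V
    by (intro iter_cong) (auto simp: sum_nonneg_eq_0_iff not_le simp del: sum_of_bool_eq)
  also have "\<dots> \<le> (iter M (\<lambda>xs. (heavy V t xs)\<^sup>2) - ?m\<^sup>2) / ?m\<^sup>2" by (rule chebyshev_zero[OF m0])
  also have "\<dots> \<le> real B * real t * ?m / ?m\<^sup>2" by (intro divide_right_mono var) simp
  also have "\<dots> = real B * real t / ?m" using m0 by (simp add: power2_eq_square)
  also have "\<dots> \<le> real B * real t / (real (card V) * ?a)"
    using m a card m0 by (intro divide_left_mono mult_pos_pos) auto
  also have "\<dots> = 2 * real B * real t * (real t / (real M * q0)) ^ t / real (card V)"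
    using M q0 t card by (simp add: power_divide mult_ac)
  finally show ?thesis .
qed

end

section \<open>Lower tail of the maximal number of visits\<close>

context nb_graph
begin

lemma of_bool_le_count_list: "of_bool (x \<in> set l) \<le> count_list l x"
  using count_list_0_iff[of l x] by (cases "count_list l x") auto

text \<open>A block started from the stationary law of the state; its starting vertex is not
  recorded.\<close>

definition uniform_block :: "nat \<Rightarrow> ('a list \<Rightarrow> real) \<Rightarrow> real" where
  "uniform_block B \<psi> = (\<Sum>f\<in>E. wmean B f (\<lambda>l _. \<psi> l)) / real (card E)"

lemma block_mean_uniform_block:
  assumes "V \<noteq> {}"
  shows "block_mean {l. length l = B \<and> set l \<subseteq> V} (uniform_block B) V B"
proof
  have E: "real (card E) > 0"
    using assms pair_finite_verts d3 by (simp add: card_arcs card_gt_0_iff)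
  fix f :: "'a list \<Rightarrow> real"
  show "uniform_block B (\<lambda>x. f x + g x) = uniform_block B f + uniform_block B g" for g
    by (simp add: uniform_block_def wmean_add sum.distrib add_divide_distrib)
  show "uniform_block B (\<lambda>x. c * f x) = c * uniform_block B f" for c
    by (simp add: uniform_block_def wmean_cmult sum_distrib_left)
  show "0 \<le> uniform_block B f" if "\<And>x. x \<in> {l. length l = B \<and> set l \<subseteq> V} \<Longrightarrow> 0 \<le> f x"
  proof -
    have "0 \<le> wmean B e (\<lambda>l _. f l)" if e: "e \<in> E" for e
    proof -
      have "wmean B e (\<lambda>_ _. 0) \<le> wmean B e (\<lambda>l _. f l)"
        using \<open>\<And>x. x \<in> {l. length l = B \<and> set l \<subseteq> V} \<Longrightarrow> 0 \<le> f x\<close> by (intro wmean_mono e) auto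
      then show ?thesis by (simp add: wmean_const e)
    qed
    then show ?thesis by (auto simp: uniform_block_def intro!: divide_nonneg_nonneg sum_nonneg)
  qed
  show "uniform_block B (\<lambda>_. 1) = 1"
    using E by (auto simp: uniform_block_def wmean_const)
qed (use pair_finite_verts in auto)

lemma wmean_dart_expansion:
  assumes "e \<in> E"
  shows "wmean k e (\<lambda>_ f. \<psi> f) = (\<Sum>f\<in>E. dart k e f * \<psi> f)"
proof -
  have "wmean k e (\<lambda>_ f. \<psi> f) = wmean k e (\<lambda>_ f'. \<Sum>f\<in>E. \<psi> f * of_bool (f' = f))"
  proof (intro wmean_cong assms)
    fix f' assume f': "f' \<in> E"
    have "(\<Sum>f\<in>E. \<psi> f * of_bool (f' = f)) = (\<Sum>f\<in>E. if f = f' then \<psi> f else 0)"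
      by (intro sum.cong) auto
    then show "\<psi> f' = (\<Sum>f\<in>E. \<psi> f * of_bool (f' = f))"
      using f' pair_finite_arcs by simp
  qed
  also have "\<dots> = (\<Sum>f\<in>E. \<psi> f * dart k e f)"
    unfolding wmean_sum[OF pair_finite_arcs] wmean_cmult dart_def ..
  finally show ?thesis by (simp add: mult.commute)
qed

text \<open>A minorisation: after \<open>K\<close> steps the state law dominates
  \<open>1 - \<eta>\<close> times the uniform one, and this suffices for nonnegative
  \<open>\<psi>\<close>.\<close>

lemma uniform_block_le_wmean:
  assumes e: "e \<in> E" and \<psi>: "\<And>l. 0 \<le> \<psi> l"
    and mix: "\<And>f. f \<in> E \<Longrightarrow> (1 - \<eta>) / real (card E) \<le> dart K e f"
  shows "(1 - \<eta>) * uniform_block B \<psi> \<le> wmean K e (\<lambda>_ f. wmean B f (\<lambda>l _. \<psi> l))"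
proof -
  have nn: "0 \<le> wmean B f (\<lambda>l _. \<psi> l)" if f: "f \<in> E" for f
    using wmean_mono[OF f, of B "\<lambda>_ _. 0" "\<lambda>l _. \<psi> l"] \<psi> by (simp add: wmean_const f)
  have "(1 - \<eta>) * uniform_block B \<psi> = (\<Sum>f\<in>E. (1 - \<eta>) / real (card E) * wmean B f (\<lambda>l _. \<psi> l))"
    by (simp add: uniform_block_def sum_distrib_left sum_divide_distrib)
  also have "\<dots> \<le> (\<Sum>f\<in>E. dart K e f * wmean B f (\<lambda>l _. \<psi> l))"
    by (intro sum_mono mult_right_mono mix nn)
  finally show ?thesis by (simp add: wmean_dart_expansion[OF e])
qed

text \<open>Splitting the walk into periods of \<open>K\<close> mixing steps, which are ignored, and \<open>B\<close> recorded steps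
  compares it with independent uniform blocks.\<close>

lemma block_comparison:
  fixes \<Phi> :: "'a list \<Rightarrow> 'a \<times> 'a \<Rightarrow> real" and F :: "'a list list \<Rightarrow> real"
  assumes V: "V \<noteq> {}" and \<eta>: "\<eta> \<le> 1"
    and mix: "\<And>e f. e \<in> E \<Longrightarrow> f \<in> E \<Longrightarrow> (1 - \<eta>) / real (card E) \<le> dart K e f"
    and F: "\<And>xs. 0 \<le> F xs"
    and dom: "\<And>l f xs. f \<in> E \<Longrightarrow> (\<And>v. occ v xs \<le> count_list l v) \<Longrightarrow> F xs \<le> \<Phi> l f"
    and e: "e \<in> E"
  shows "(1 - \<eta>) ^ M * mean_functional.iter (uniform_block B) M F \<le> wmean (M * (K + B)) e \<Phi>"
  using F dom
proof (induction M arbitrary: F \<Phi>)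
  interpret block_mean "{l. length l = B \<and> set l \<subseteq> V}" "uniform_block B" V B
    by (rule block_mean_uniform_block[OF V])
  {
    case 0
    then show ?case using e by simp
  next
    case (Suc M)
    \<comment> \<open>The last period of the walk is matched with the head of the block list. The
      reversed order is immaterial, as \<open>dom\<close> only compares counts.\<close>
    define F' where "F' = (\<lambda>xs. (1 - \<eta>) * uniform_block B (\<lambda>x. F (x # xs)))"
    define \<Phi>' where "\<Phi>' = (\<lambda>l f. wmean K f (\<lambda>g f'. wmean B f' (\<lambda>x. \<Phi> (l @ g @ x))))"
    have "(1 - \<eta>) ^ Suc M * iter (Suc M) F = (1 - \<eta>) ^ M * iter M F'"
      by (simp add: F'_def iter_cmult)
    also have "\<dots> \<le> wmean (M * (K + B)) e \<Phi>'"
    proof (rule Suc.IH)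
      show "0 \<le> F' xs" for xs
        using nonneg[of "\<lambda>x. F (x # xs)"] Suc.prems(1) \<eta> by (simp add: F'_def)
      fix l :: "'a list" and f and xs :: "'a list list"
      assume f: "f \<in> E" and le: "\<And>v. occ v xs \<le> count_list l v"
      have "F' xs \<le> wmean K f (\<lambda>_ f'. wmean B f' (\<lambda>x _. F (x # xs)))"
        unfolding F'_def by (intro uniform_block_le_wmean f mix Suc.prems(1))
      also have "\<dots> \<le> \<Phi>' l f"
        unfolding \<Phi>'_def
      proof (intro wmean_mono f Suc.prems(2))
        fix g x :: "'a list" and v
        show "occ v (x # xs) \<le> count_list (l @ g @ x) v"
          using le[of v] of_bool_le_count_list[of v x] by (simp add: occ_Cons)
      qed
      finally show "F' xs \<le> \<Phi>' l f" .
    qed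
    also have "\<dots> = wmean (Suc M * (K + B)) e \<Phi>"
    proof -
      have "Suc M * (K + B) = M * (K + B) + (K + B)" by simp
      then show ?thesis unfolding \<Phi>'_def by (simp only: wmean_append)
    qed
    finally show ?case .
  }
qed

section \<open>Visits within one stationary block\<close>

lemma wmean_count: "wmean M e (\<lambda>l _. real (count_list l v)) = (\<Sum>i<M. hit (Suc i) e v)" if "e \<in> E"
  using that
proof (induction M arbitrary: e)
  case (Suc M)
  have *: "wmean M (snd e, c) (\<lambda>l _. real (count_list (c # l) v)) = (\<Sum>i<Suc M. hit i (snd e, c) v)"
    if c: "c \<in> succs e" for c
  proof -
    have arc: "(snd e, c) \<in> E" by (rule succs_arc[OF c])
    have "wmean M (snd e, c) (\<lambda>l _. real (count_list (c # l) v)) =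
        wmean M (snd e, c) (\<lambda>l _. of_bool (c = v) + real (count_list l v))"
      by (intro wmean_cong arc) auto
    then show ?thesis
      by (subst sum.lessThan_Suc_shift) (simp add: wmean_add wmean_const[OF arc] Suc.IH[OF arc] hit_0)
  qed
  have "wmean (Suc M) e (\<lambda>l _. real (count_list l v)) = (\<Sum>c\<in>succs e. \<Sum>i<Suc M. hit i (snd e, c) v) / (real d - 1)"
    using * by (simp del: sum.lessThan_Suc count_list.simps)
  also have "\<dots> = (\<Sum>i<Suc M. hit (Suc i) e v)"
    unfolding hit_Suc by (subst sum.swap) (simp add: sum_divide_distrib del: sum.lessThan_Suc)
  finally show ?case .
qed simp

text \<open>After the first visit at most one further visit is expected.\<close>

lemma wmean_count_le_visit:
  assumes "\<And>a j. (a, v) \<in> E \<Longrightarrow> j < M \<Longrightarrow> (\<Sum>i<j. hit (Suc i) (a, v) v) \<le> 1" and "e \<in> E"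
  shows "wmean M e (\<lambda>l _. real (count_list l v)) \<le> 2 * wmean M e (\<lambda>l _. of_bool (v \<in> set l))"
  using assms
proof (induction M arbitrary: e)
  case (Suc M)
  have "wmean M (snd e, c) (\<lambda>l _. real (count_list (c # l) v)) \<le> 2 * wmean M (snd e, c) (\<lambda>l _. of_bool (v \<in> set (c # l)))"
    if c: "c \<in> succs e" for c
  proof (cases "c = v")
    case True
    have arc: "(snd e, v) \<in> E" using succs_arc[OF c] True by simp
    have "wmean M (snd e, v) (\<lambda>l _. real (count_list l v) + 1) \<le> 2"
      using Suc.prems(1)[OF arc, of M] by (simp add: wmean_add wmean_count[OF arc] wmean_const[OF arc])
    then show ?thesis using True by (simp add: wmean_const[OF arc] add.commute)
  next
    case False
    then show ?thesis using Suc.IH[of "(snd e, c)"] Suc.prems succs_arc[OF c] by simp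
  qed
  then show ?case using d_minus_1_pos
    by (simp add: sum_distrib_left divide_right_mono sum_mono del: count_list.simps set_simps)
qed simp

text \<open>Stationarity makes the mean number of visits exactly \<open>B / card V\<close>, and
  \<open>wmean_count_le_visit\<close> limits the share due to repetitions.\<close>

lemma uniform_block_visit:
  assumes v: "v \<in> V" and short: "\<And>a j. (a, v) \<in> E \<Longrightarrow> j < B \<Longrightarrow> (\<Sum>i<j. hit (Suc i) (a, v) v) \<le> 1"
  shows "uniform_block B (\<lambda>l. of_bool (v \<in> set l)) \<le> real B / real (card V)"
    and "real B / (2 * real (card V)) \<le> uniform_block B (\<lambda>l. of_bool (v \<in> set l))"
proof -
  have E: "real (card E) = real (card V) * real d" by (simp add: card_arcs)
  have V: "real (card V) > 0" using v pair_finite_verts by (auto simp: card_gt_0_iff)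
  have "uniform_block B (\<lambda>l. real (count_list l v)) = (\<Sum>i<B. \<Sum>f\<in>E. hit (Suc i) f v) / real (card E)"
    unfolding uniform_block_def by (subst sum.swap) (simp add: wmean_count)
  also have "\<dots> = real B / real (card V)"
    unfolding sum_hit_arcs[OF v] E using d3 V by simp
  finally have count: "uniform_block B (\<lambda>l. real (count_list l v)) = real B / real (card V)" .
  have "of_bool (v \<in> set l) \<le> real (count_list l v)" for l
    using of_bool_le_count_list[of v l] by (metis of_nat_le_iff of_nat_of_bool)
  then have "uniform_block B (\<lambda>l. of_bool (v \<in> set l)) \<le> uniform_block B (\<lambda>l. real (count_list l v))"
    unfolding uniform_block_def by (intro divide_right_mono sum_mono wmean_mono) auto
  then show "uniform_block B (\<lambda>l. of_bool (v \<in> set l)) \<le> real B / real (card V)" by (simp add: count)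
  have "uniform_block B (\<lambda>l. real (count_list l v)) \<le> (\<Sum>f\<in>E. 2 * wmean B f (\<lambda>l _. of_bool (v \<in> set l))) / real (card E)"
    unfolding uniform_block_def by (intro divide_right_mono sum_mono wmean_count_le_visit short) auto
  also have "\<dots> = 2 * uniform_block B (\<lambda>l. of_bool (v \<in> set l))"
    by (simp add: uniform_block_def sum_distrib_left)
  finally show "real B / (2 * real (card V)) \<le> uniform_block B (\<lambda>l. of_bool (v \<in> set l))"
    using V by (simp add: count field_simps)
qed

text \<open>Gaps and blocks both have length \<open>K\<close>; the steps after the last period can
  only add visits. \<open>M K \<ge> n / 4\<close> and visit probability at least
  \<open>K / (2 n)\<close> give mean occupation at least \<open>1 / 8\<close>, whence
  \<open>(8 t)^t\<close>; \<open>M K \<le> n / 2\<close> is the hypothesis of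
  \<open>occ_lower_tail\<close>. Imperfect mixing costs
  \<open>1 - (1 - \<eta>)^M \<le> M \<eta>\<close>.\<close>

lemma visits_lower_tail:
  assumes cV: "card V = n" and n: "n > 0" and e: "e \<in> E"
    and short: "\<And>a v j. (a, v) \<in> E \<Longrightarrow> j < K \<Longrightarrow> (\<Sum>i<j. hit (Suc i) (a, v) v) \<le> 1"
    and mix: "\<And>e f. e \<in> E \<Longrightarrow> f \<in> E \<Longrightarrow> (1 - \<eta>) / (real n * real d) \<le> dart K e f"
    and \<eta>: "0 \<le> \<eta>" "\<eta> \<le> 1" and K: "K > 0" and t: "1 \<le> t" "t \<le> M" and L: "M * (2 * K) \<le> L"
    and M: "real n \<le> real M * (4 * real K)" "2 * (real M * real K) \<le> real n"
  shows "1 - real M * \<eta> - 2 * real K * real t * (8 * real t) ^ t / real n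
    \<le> wmean L e (\<lambda>l _. of_bool (\<exists>v\<in>V. t \<le> count_list l v))"
proof -
  have V: "V \<noteq> {}" using cV n by auto
  interpret block_mean "{l. length l = K \<and> set l \<subseteq> V}" "uniform_block K" V K
    by (rule block_mean_uniform_block[OF V])
  let ?F = "\<lambda>xs. of_bool (\<exists>v\<in>V. t \<le> occ v xs) :: real"
  let ?\<Phi> = "\<lambda>l f. wmean (L - M * (K + K)) f (\<lambda>l' _. of_bool (\<exists>v\<in>V. t \<le> count_list (l @ l') v)) :: real"
  define b where "b = 2 * real K * real t * (8 * real t) ^ t / real n"
  have "iter M (\<lambda>xs. of_bool (\<forall>v\<in>V. occ v xs < t))
      \<le> 2 * real K * real t * (real t / (real M * (real K / (2 * real n)))) ^ t / real (card V)"
  proof (rule no_heavy_vertex[where ?q1.0 = "real K / real n"])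
    fix v assume v: "v \<in> V"
    show "real K / (2 * real n) \<le> uniform_block K (\<lambda>x. of_bool (v \<in> set x))"
      using uniform_block_visit(2)[OF v short] by (simp add: cV)
    show "uniform_block K (\<lambda>x. of_bool (v \<in> set x)) \<le> real K / real n"
      using uniform_block_visit(1)[OF v short] by (simp add: cV)
  qed (use K n M t V in \<open>auto simp: field_simps\<close>)
  also have "\<dots> \<le> b"
  proof -
    have "real M * (real K / (2 * real n)) \<ge> 1 / 8" using M(1) n by (simp add: field_simps)
    then have "real t / (real M * (real K / (2 * real n))) \<le> real t / (1 / 8)"
      using K n t by (intro divide_left_mono mult_pos_pos) auto
    then have "(real t / (real M * (real K / (2 * real n)))) ^ t \<le> (8 * real t) ^ t"
      by (intro power_mono) auto
    then show ?thesis unfolding b_def cV by (intro divide_right_mono mult_left_mono) auto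
  qed
  finally have none: "iter M (\<lambda>xs. of_bool (\<forall>v\<in>V. occ v xs < t)) \<le> b" .
  have F: "iter M ?F = 1 - iter M (\<lambda>xs. of_bool (\<forall>v\<in>V. occ v xs < t))"
  proof -
    have "iter M ?F = iter M (\<lambda>xs. 1 - of_bool (\<forall>v\<in>V. occ v xs < t))"
      by (intro iter_cong) (auto simp: not_less)
    then show ?thesis using mean_functional.one[OF mean_functional_iter] by (simp add: iter_diff)
  qed
  have b0: "b \<ge> 0" by (simp add: b_def)
  have "1 - real M * \<eta> - b \<le> (1 - \<eta>) ^ M * iter M ?F"
  proof -
    have F01: "0 \<le> iter M ?F" "iter M ?F \<le> 1" "1 - b \<le> iter M ?F"
      using F none mean_functional.nonneg[OF mean_functional_iter, of M ?F]
        mean_functional.nonneg[OF mean_functional_iter, of M "\<lambda>xs. of_bool (\<forall>v\<in>V. occ v xs < t)"] by auto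
    have p: "1 - real M * \<eta> \<le> (1 - \<eta>) ^ M" "(1 - \<eta>) ^ M \<le> 1" "0 \<le> (1 - \<eta>) ^ M"
      using Bernoulli_inequality[of "- \<eta>" M] \<eta> by (auto intro: power_le_one)
    have "(1 - (1 - \<eta>) ^ M) * iter M ?F \<le> (1 - (1 - \<eta>) ^ M) * 1"
      using p F01 by (intro mult_left_mono) auto
    then show ?thesis using p F01 by (simp add: algebra_simps)
  qed
  also have "\<dots> \<le> wmean (M * (K + K)) e ?\<Phi>"
  proof (rule block_comparison[OF V \<eta>(2) _ _ _ e])
    show "(1 - \<eta>) / real (card E) \<le> dart K e f" if "e \<in> E" "f \<in> E" for e f
      using mix[OF that] by (simp add: card_arcs cV)
    fix l :: "'a list" and f and xs :: "'a list list"
    assume f: "f \<in> E" and le: "\<And>v. occ v xs \<le> count_list l v"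
    have "?F xs = wmean (L - M * (K + K)) f (\<lambda>_ _. ?F xs)" by (simp add: wmean_const f)
    also have "\<dots> \<le> ?\<Phi> l f"
    proof (intro wmean_mono f)
      fix l' :: "'a list"
      have "occ v xs \<le> count_list (l @ l') v" for v using le[of v] by simp
      then show "?F xs \<le> of_bool (\<exists>v\<in>V. t \<le> count_list (l @ l') v)"
        by (auto simp: of_bool_def intro: order_trans)
    qed
    finally show "?F xs \<le> ?\<Phi> l f" .
  qed simp
  also have "\<dots> = wmean L e (\<lambda>l _. of_bool (\<exists>v\<in>V. t \<le> count_list l v))"
    using wmean_append[of "M * (K + K)" "L - M * (K + K)" e "\<lambda>l _. of_bool (\<exists>v\<in>V. t \<le> count_list l v)"] L
    by (simp add: mult_2)
  finally show ?thesis by (simp add: b_def)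
qed

section \<open>The law of the walk as a list\<close>

text \<open>The final state can be read off the visited vertices, as \<open>nb_step\<close> does: in
  a list of length \<open>length l + 2\<close>, index \<open>length l\<close> is the last but
  one.\<close>

lemma wmean_final_dart:
  "wmean k e \<Phi> = wmean k e (\<lambda>l _. \<Phi> l ((fst e # snd e # l) ! length l, last (snd e # l)))"
proof (induction k arbitrary: e \<Phi>)
  case (Suc k)
  have "wmean k (snd e, c) (\<lambda>l. \<Phi> (c # l)) =
      wmean k (snd e, c) (\<lambda>l _. \<Phi> (c # l) ((fst e # snd e # c # l) ! length (c # l), last (snd e # c # l)))" for c
    by (subst Suc.IH) simp
  then show ?case by simp
qed simp

lemma neighbors_nonempty: "v \<in> V \<Longrightarrow> neighbors G v \<noteq> {}"
  using deg d3 by fastforce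

lemma succs_nonempty: "e \<in> E \<Longrightarrow> succs e \<noteq> {}"
  using card_succs d3 by fastforce

lemma nb_step_arc:
  assumes "length ws \<ge> 2" "(ws ! (length ws - 2), last ws) \<in> E"
  shows "nb_step G ws = pmf_of_set (succs (ws ! (length ws - 2), last ws))"
  using assms by (simp add: nb_step_def succs_def)

text \<open>Finite support turns expectations into finite sums, and the final arc identifies the
  next step with \<open>succs\<close>.\<close>

lemma nb_walk_support:
  assumes v: "v \<in> V"
  shows "finite (set_pmf (nb_walk G v (Suc k))) \<and>
    (\<forall>ws\<in>set_pmf (nb_walk G v (Suc k)). length ws = Suc (Suc k) \<and> (ws ! k, last ws) \<in> E)"
proof (induction k)
  case 0
  show ?case
    using neighbors_nonempty[OF v] by (simp add: nb_step_def set_pmf_of_set neighbors_iff)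
next
  case (Suc k)
  let ?A = "set_pmf (nb_walk G v (Suc k))"
  have step: "set_pmf (nb_step G ws) = succs (ws ! k, ws ! Suc k)" if "ws \<in> ?A" for ws
  proof -
    have len: "length ws = Suc (Suc k)" and arc: "(ws ! k, last ws) \<in> E" using Suc.IH that by blast+
    have "ws \<noteq> []" using len by auto
    then have "last ws = ws ! Suc k" using len by (simp add: last_conv_nth)
    moreover have "nb_step G ws = pmf_of_set (succs (ws ! k, last ws))"
      using nb_step_arc[of ws] len arc by simp
    ultimately show ?thesis
      using set_pmf_of_set[OF succs_nonempty[OF arc] finite_succs] by simp
  qed
  have supp: "set_pmf (nb_walk G v (Suc (Suc k))) = (\<Union>ws\<in>?A. (\<lambda>w. ws @ [w]) ` succs (ws ! k, ws ! Suc k))"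
    unfolding nb_walk.simps(2)[of G v "Suc k"] set_bind_pmf set_map_pmf
    by (rule SUP_cong[OF refl]) (simp only: step)
  show ?case
  proof (intro conjI ballI)
    show "finite (set_pmf (nb_walk G v (Suc (Suc k))))"
      unfolding supp using Suc.IH by (intro finite_UN_I) auto
  next
    fix ws' assume "ws' \<in> set_pmf (nb_walk G v (Suc (Suc k)))"
    then obtain ws w where ws: "ws \<in> set_pmf (nb_walk G v (Suc k))"
      and w: "w \<in> succs (ws ! k, ws ! Suc k)" and ws': "ws' = ws @ [w]"
      unfolding supp by blast
    have len: "length ws = Suc (Suc k)" using Suc.IH ws by blast
    show "length ws' = Suc (Suc (Suc k))" using len ws' by simp
    show "(ws' ! Suc k, last ws') \<in> E" using succs_arc[OF w] len by (simp add: ws' nth_append)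
  qed
qed

text \<open>The first step has \<open>d\<close> choices; afterwards \<open>(v, c)\<close> is a
  state. \<open>nb_walk\<close> grows at the end and \<open>wmean\<close> at the front, which
  \<open>wmean_append\<close> reconciles.\<close>

lemma expectation_nb_walk:
  assumes v: "v \<in> V"
  shows "measure_pmf.expectation (nb_walk G v (Suc k)) f =
    (\<Sum>c\<in>neighbors G v. wmean k (v, c) (\<lambda>l _. f (v # c # l))) / real d"
proof (induction k arbitrary: f)
  case 0
  have ne: "neighbors G v \<noteq> {}" using deg[OF v] d3 by auto
  then show ?case
    by (simp add: bind_return_pmf nb_step_def integral_pmf_of_set deg[OF v])
next
  case (Suc k)
  define g where "g ws = (\<Sum>w\<in>neighbors G (last ws) - {ws ! (length ws - 2)}. f (ws @ [w])) / (real d - 1)" for ws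
  have "measure_pmf.expectation (nb_walk G v (Suc (Suc k))) f = measure_pmf.expectation (nb_walk G v (Suc k)) g"
  proof -
    let ?p = "nb_walk G v (Suc k)"
    have fin: "finite (set_pmf ?p)" and arc: "\<And>ws. ws \<in> set_pmf ?p \<Longrightarrow> length ws = Suc (Suc k) \<and> (ws ! k, last ws) \<in> E"
      using nb_walk_support[OF v] by auto
    have step: "nb_step G ws = pmf_of_set (succs (ws ! k, last ws))" if "ws \<in> set_pmf ?p" for ws
      using nb_step_arc[of ws] arc[OF that] by simp
    have fin': "finite (set_pmf (map_pmf (\<lambda>w. ws @ [w]) (nb_step G ws)))" if "ws \<in> set_pmf ?p" for ws
      using step[OF that] arc[OF that] succs_nonempty by (simp add: set_pmf_of_set)
    have "measure_pmf.expectation (map_pmf (\<lambda>w. ws @ [w]) (nb_step G ws)) f = g ws" if "ws \<in> set_pmf ?p" for ws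
      using arc[OF that] succs_nonempty[of "(ws ! k, last ws)"]
      by (simp add: step[OF that] integral_pmf_of_set real_card_succs g_def) (simp add: succs_def)
    then have "measure_pmf.expectation (nb_walk G v (Suc (Suc k))) f = (\<Sum>ws\<in>set_pmf ?p. pmf ?p ws *\<^sub>R g ws)"
      unfolding nb_walk.simps(2)[of G v "Suc k"]
      by (subst pmf_expectation_bind[OF fin fin' order_refl]) auto
    also have "\<dots> = measure_pmf.expectation ?p g"
      by (rule integral_measure_pmf[OF fin, symmetric]) auto
    finally show ?thesis .
  qed
  also have "\<dots> = (\<Sum>c\<in>neighbors G v. wmean k (v, c) (\<lambda>l _. g (v # c # l))) / real d"
    by (rule Suc.IH)
  also have "\<dots> = (\<Sum>c\<in>neighbors G v. wmean (Suc k) (v, c) (\<lambda>l _. f (v # c # l))) / real d"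
  proof -
    have "wmean k (v, c) (\<lambda>l _. g (v # c # l)) = wmean (k + 1) (v, c) (\<lambda>l _. f (v # c # l))" for c
      unfolding wmean_append
      by (subst (2) wmean_final_dart) (simp add: g_def succs_def)
    then show ?thesis by simp
  qed
  finally show ?case .
qed

lemma prob_nb_walk:
  assumes v: "v \<in> V"
  shows "measure_pmf.prob (nb_walk G v (Suc k)) S =
    (\<Sum>c\<in>neighbors G v. wmean k (v, c) (\<lambda>l _. of_bool (v # c # l \<in> S))) / real d"
  using expectation_nb_walk[OF v, of k "indicator S"] by (simp add: indicator_def of_bool_def)

lemma max_visits_Cons:
  assumes "length l = n"
  shows "max_visits G n (w # l) = Max (count_list l ` V)"
proof -
  have "{i. 1 \<le> i \<and> i \<le> n \<and> (w # l) ! i = v} = Suc ` {i. i < length l \<and> l ! i = v}" for v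
  proof -
    have "i \<in> Suc ` {i. i < length l \<and> l ! i = v}" if "1 \<le> i" "i \<le> n" "(w # l) ! i = v" for i
      using that assms by (intro image_eqI[of _ _ "i - 1"]) (auto simp: nth_Cons')
    moreover have "1 \<le> i \<and> i \<le> n \<and> (w # l) ! i = v" if "i \<in> Suc ` {i. i < length l \<and> l ! i = v}" for i
      using that assms by auto
    ultimately show ?thesis by blast
  qed
  then have "card {i. 1 \<le> i \<and> i \<le> n \<and> (w # l) ! i = v} = card {i. i < length l \<and> v = l ! i}" for v
    by (simp add: card_image) (rule arg_cong[of _ _ card], blast)
  then show ?thesis
    unfolding max_visits_def by (simp add: count_list_eq_length_filter length_filter_conv_card)
qed

section \<open>Concentration\<close>

text \<open>The non-asymptotic form. The three errors come from imperfect mixing between blocks,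
  from the second moment, and from Markov's inequality with \<open>\<theta> = a\<close>.\<close>

lemma max_visits_concentration:
  assumes w0: "w0 \<in> V" and cV: "card V = n" and n: "n \<ge> 2"
    and hit: "\<And>e v k. e \<in> E \<Longrightarrow> v \<in> V \<Longrightarrow> \<bar>hit k e v - 1 / real n\<bar> \<le> 5 * (real n * (C * \<rho> ^ k))"
    and dart: "\<And>e f k. e \<in> E \<Longrightarrow> f \<in> E \<Longrightarrow> \<bar>dart k e f - 1 / (real n * real d)\<bar> \<le> 10 * (real n * (C * \<rho> ^ k))"
    and C: "C \<ge> 0" and \<rho>: "0 \<le> \<rho>" "\<rho> \<le> 1"
    and mix: "10 * (real n * (C * \<rho> ^ K)) \<le> 1 / (real n * real n * real d)"
    and girth: "enat (2 * r) < girth G"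
    and a: "a \<ge> 1" and early: "a * (real K / (real d - 1) ^ r) \<le> 1 / 4"
    and K: "K > 0" and b: "b > 0" and T: "T = nat \<lceil>b\<rceil>" "T * (2 * K) \<le> n - 1"
  shows "1 - 1 / (2 * real K) - 2 * real K * real T * (8 * real T) ^ T / real n
      - real n * ((2 + 2 * a * real K) * exp (8 * a) * a powr (1 - a))
    \<le> measure_pmf.prob (nb_walk G w0 n) {ws. b \<le> real (max_visits G n ws) \<and> real (max_visits G n ws) \<le> a}"
    (is "1 - ?k - ?lo - ?up \<le> measure_pmf.prob _ ?S")
proof -
  define L where "L = n - 1"
  have nL: "n = Suc L" using n by (simp add: L_def)
  have V: "V \<noteq> {}" using w0 by auto
  have late: "hit (Suc i) e v \<le> 2 / real n" if "e \<in> E" "v \<in> V" "K \<le> i" for e v i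
  proof -
    have "real n * (C * \<rho> ^ Suc i) \<le> real n * (C * \<rho> ^ K)"
      using that C \<rho> by (intro mult_left_mono power_decreasing) auto
    moreover have "1 / (real n * real n * real d) \<le> 1 / real n"
    proof (intro divide_left_mono)
      have "real n * 1 \<le> real n * (real n * real d)"
        using n d3 mult_mono[of 1 "real n" 1 "real d"] by (intro mult_left_mono) auto
      then show "real n \<le> real n * real n * real d" by (simp add: mult.assoc)
    qed (use n d3 in auto)
    moreover have "0 \<le> real n * (C * \<rho> ^ K)" using C \<rho> by simp
    ultimately have "5 * (real n * (C * \<rho> ^ Suc i)) \<le> 1 / real n"
      using mix by linarith
    then show ?thesis using hit[OF that(1,2), of "Suc i"] by linarith
  qed
  have dm: "(real d - 1) ^ r > 0" using d_minus_1_pos by simp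
  have return: "(\<Sum>i<K. hit (Suc i) (u, v) v) \<le> real K / (real d - 1) ^ r" if uv: "(u, v) \<in> E" for u v
  proof -
    \<comment> \<open>No return happens up to time \<open>r\<close>, which is below the girth;
      afterwards the bound at time \<open>r\<close> persists.\<close>
    have "hit (Suc i) (u, v) v \<le> 1 / (real d - 1) ^ r" for i
    proof (cases "Suc i \<le> r")
      case True
      then have "enat (Suc i) \<le> enat (2 * r)" by simp
      then have "enat (Suc i) < girth G" using girth by (rule le_less_trans)
      then show ?thesis using hit_return_zero[OF uv, of "Suc i"] dm by simp
    next
      case False
      then show ?thesis
        by (intro hit_bound_mono[of r, OF hit_le_girth[OF _ girth]] uv) auto
    qed
    then have "(\<Sum>i<K. hit (Suc i) (u, v) v) \<le> (\<Sum>i<K. 1 / (real d - 1) ^ r)" by (intro sum_mono)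
    then show ?thesis by simp
  qed
  \<comment> \<open>\<open>l\<close> omits the first step \<open>c\<close>, which may add one visit;
    hence the threshold \<open>a - 1\<close>.\<close>
  have upper: "wmean L (w0, c) (\<lambda>l _. of_bool (\<exists>v\<in>V. a - 1 \<le> real (count_list l v))) \<le> ?up"
    if c: "(w0, c) \<in> E" for c
  proof -
    have "(a - 1) * (\<Sum>i<K. hit (Suc i) (u, v) v) \<le> 1 / 4" if uv: "(u, v) \<in> E" for u v
    proof -
      have "(a - 1) * (\<Sum>i<K. hit (Suc i) (u, v) v) \<le> a * (real K / (real d - 1) ^ r)"
        using a return[OF uv] hit_nonneg by (intro mult_mono) (auto intro: sum_nonneg)
      then show ?thesis using early by linarith
    qed
    from visits_upper_tail[OF a _ _ this late c cV, of L "a - 1"] n nL show ?thesis by simp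
  qed
  have lower: "1 - ?k - ?lo \<le> wmean L (w0, c) (\<lambda>l _. of_bool (\<exists>v\<in>V. T \<le> count_list l v))"
    if c: "(w0, c) \<in> E" for c
  proof -
    \<comment> \<open>As many periods of \<open>2 K\<close> steps as fit; the remainder is shorter
      than one period, so at least half of the \<open>n\<close> steps are covered.\<close>
    define M where "M = L div (2 * K)"
    have T1: "1 \<le> T" using b T by linarith
    have TM: "T \<le> M" using T(2) K by (simp add: M_def L_def less_eq_div_iff_mult_less_eq)
    have MKL: "M * (2 * K) \<le> L" by (simp add: M_def)
    have "L < M * (2 * K) + 2 * K" 
      using mod_less_divisor[of "2 * K" L] div_mult_mod_eq[of L "2 * K"] K unfolding M_def by linarith
    moreover have "2 * K \<le> M * (2 * K)" using T1 TM by simp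
    ultimately have "n \<le> M * (2 * K) + M * (2 * K)" using nL by linarith
    then have "n \<le> M * (4 * K)" by (simp add: algebra_simps)
    then have M1: "real n \<le> real M * (4 * real K)" by (metis of_nat_le_iff of_nat_mult of_nat_numeral)
    have "2 * (M * K) \<le> n" using MKL nL by (simp add: mult_ac)
    then have M2: "2 * (real M * real K) \<le> real n" by (metis of_nat_le_iff of_nat_mult of_nat_numeral)
    have short: "(\<Sum>i<j. hit (Suc i) (u, v) v) \<le> 1" if uv: "(u, v) \<in> E" and j: "j < K" for u v j
    proof -
      have "(\<Sum>i<j. hit (Suc i) (u, v) v) \<le> (\<Sum>i<K. hit (Suc i) (u, v) v)"
        using j hit_nonneg by (intro sum_mono2) auto
      also have "\<dots> \<le> 1 * (real K / (real d - 1) ^ r)" using return[OF uv] by simp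
      also have "\<dots> \<le> a * (real K / (real d - 1) ^ r)" using a dm by (intro mult_right_mono) auto
      finally show ?thesis using early by linarith
    qed
    \<comment> \<open>With \<open>\<eta> = 1 / n\<close>, the \<open>M \<le> n / (2 K)\<close>
      blocks lose at most \<open>1 / (2 K)\<close> in total.\<close>
    have mix': "(1 - 1 / real n) / (real n * real d) \<le> dart K e f" if "e \<in> E" "f \<in> E" for e f
    proof -
      have "(1 - 1 / real n) / (real n * real d) = 1 / (real n * real d) - 1 / (real n * real n * real d)"
        by (simp add: diff_divide_distrib)
      moreover have "s \<le> x" if "\<bar>x - p\<bar> \<le> q" "q \<le> y" "s = p - y" for s x p q y :: real
        using that by linarith
      ultimately show ?thesis using dart[OF that, of K] mix by blast
    qed
    have "1 - real M * (1 / real n) - ?lo \<le> wmean L (w0, c) (\<lambda>l _. of_bool (\<exists>v\<in>V. T \<le> count_list l v))"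
      using n by (intro visits_lower_tail[OF cV _ c short mix' _ _ K T1 TM MKL M1 M2]) auto
    moreover have "real M * (1 / real n) \<le> ?k" using M2 K n by (simp add: field_simps)
    ultimately show ?thesis by linarith
  qed
  have "1 - ?k - ?lo - ?up \<le> wmean L (w0, c) (\<lambda>l _. of_bool (w0 # c # l \<in> ?S))" if c: "(w0, c) \<in> E" for c
  proof -
    let ?A = "\<lambda>l. of_bool (\<exists>v\<in>V. T \<le> count_list l v) :: real"
    let ?B = "\<lambda>l. of_bool (\<exists>v\<in>V. a - 1 \<le> real (count_list l v)) :: real"
    \<comment> \<open>The indicator of the target event is at least that of the lower event minus
      that of exceeding the upper threshold.\<close>
    have "1 - ?k - ?lo - ?up \<le> wmean L (w0, c) (\<lambda>l _. ?A l + - 1 * ?B l)"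
      unfolding wmean_add wmean_cmult using upper[OF c] lower[OF c] by simp
    also have "\<dots> \<le> wmean L (w0, c) (\<lambda>l _. of_bool (w0 # c # l \<in> ?S))"
    proof (intro wmean_mono c)
      fix l :: "'a list" assume l: "length l = L"
      let ?m = "Max (count_list (c # l) ` V)"
      have mv: "max_visits G n (w0 # c # l) = ?m"
        using l nL by (intro max_visits_Cons) simp
      have fin: "finite (count_list (c # l) ` V)" using pair_finite_verts by simp
      have ge: "b \<le> real (max_visits G n (w0 # c # l))" if "v \<in> V" "T \<le> count_list l v" for v
      proof -
        have "T \<le> count_list (c # l) v" using that by simp
        also have "\<dots> \<le> ?m" using fin that by (intro Max_ge) auto
        finally show ?thesis unfolding mv using T by linarith
      qed
      have le: "real (max_visits G n (w0 # c # l)) \<le> a" if "\<And>v. v \<in> V \<Longrightarrow> real (count_list l v) < a - 1"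
      proof -
        have "?m \<in> count_list (c # l) ` V" using fin V by (intro Max_in) auto
        then obtain v where v: "v \<in> V" "?m = count_list (c # l) v" by blast
        have "count_list (c # l) v \<le> count_list l v + 1" by simp
        then show ?thesis using that[OF v(1)] unfolding mv v(2) by linarith
      qed
      show "?A l + - 1 * ?B l \<le> of_bool (w0 # c # l \<in> ?S)"
      proof (cases "\<exists>v\<in>V. a - 1 \<le> real (count_list l v)")
        case False
        then have "real (max_visits G n (w0 # c # l)) \<le> a" by (intro le) force
        then show ?thesis using ge by auto
      qed simp
    qed
    finally show ?thesis .
  qed
  then have "(\<Sum>c\<in>neighbors G w0. 1 - ?k - ?lo - ?up) / real d \<le>
      (\<Sum>c\<in>neighbors G w0. wmean L (w0, c) (\<lambda>l _. of_bool (w0 # c # l \<in> ?S))) / real d"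
    by (intro divide_right_mono sum_mono) (auto simp: neighbors_iff)
  also have "\<dots> = measure_pmf.prob (nb_walk G w0 n) ?S"
    unfolding nL by (rule prob_nb_walk[OF w0, symmetric])
  finally show ?thesis using d3 by (simp add: deg[OF w0])
qed

end

section \<open>Asymptotics of the threshold\<close>

definition visits_scale :: "real \<Rightarrow> real \<Rightarrow> real" where
  "visits_scale \<eta> x = (1 + (1 + \<eta>) * (ln (ln (ln x)) / ln (ln x))) * (ln x / ln (ln x))"

text \<open>\<open>visits_scale\<close> is affine in \<open>\<eta>\<close> with positive slope, so
  the equation can be solved for \<open>\<eta>\<close>.\<close>

lemma visits_scale_between:
  assumes pos: "ln x > 0" "ln (ln x) > 0" "ln (ln (ln x)) > 0"
    and y: "visits_scale (- \<epsilon>) x \<le> y" "y \<le> visits_scale \<epsilon> x"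
  shows "\<exists>\<eta>. \<bar>\<eta>\<bar> \<le> \<epsilon> \<and> y = visits_scale \<eta> x"
proof -
  define p q where "p = ln (ln (ln x)) / ln (ln x)" and "q = ln x / ln (ln x)"
  have pq: "p > 0" "q > 0" using pos by (auto simp: p_def q_def)
  have s: "visits_scale \<eta> x = (1 + p) * q + \<eta> * (p * q)" for \<eta>
    by (simp add: visits_scale_def p_def[symmetric] q_def[symmetric] algebra_simps)
  define \<eta> where "\<eta> = (y - (1 + p) * q) / (p * q)"
  have \<eta>: "\<eta> * (p * q) = y - (1 + p) * q" using pq by (simp add: \<eta>_def)
  have "\<eta> * (p * q) \<le> \<epsilon> * (p * q)" "(- \<epsilon>) * (p * q) \<le> \<eta> * (p * q)"
    using y unfolding \<eta> s by linarith+
  then have "\<eta> \<le> \<epsilon>" "- \<epsilon> \<le> \<eta>"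
    using mult_right_le_imp_le[OF _ mult_pos_pos[OF pq]] by blast+
  then have "\<bar>\<eta>\<bar> \<le> \<epsilon>" by linarith
  then show ?thesis using \<eta> by (intro exI[of _ \<eta>]) (simp add: s)
qed

text \<open>\<open>c\<close> is chosen so that \<open>\<rho>^K \<le> n^(-4)\<close>; one further
  power of \<open>n\<close> absorbs the constant \<open>10 C D\<close>.\<close>

lemma mixing_time_bound:
  assumes \<rho>: "0 < \<rho>" "\<rho> < 1" and c: "c = 4 / (- ln \<rho>)" and K: "c * ln n \<le> real K"
    and n: "n \<ge> 1" "10 * C * D \<le> n" and C: "C \<ge> 0" and D: "D > 0"
  shows "10 * (n * (C * \<rho> ^ K)) \<le> 1 / (n * n * D)"
proof -
  have l: "ln \<rho> < 0" using \<rho> by simp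
  have "\<rho> ^ K = exp (ln \<rho> * real K)" using \<rho> by (simp add: exp_of_nat2_mult)
  also have "ln \<rho> * real K \<le> ln \<rho> * (c * ln n)" using K l by (intro mult_left_mono_neg) auto
  also have "ln \<rho> * (c * ln n) = - (4 * ln n)" using l by (simp add: c)
  also have "exp (- (4 * ln n)) = 1 / n ^ 4"
    using n by (simp add: exp_minus exp_of_nat_mult[of 4, simplified] inverse_eq_divide)
  finally have r: "\<rho> ^ K \<le> 1 / n ^ 4" by simp
  have "10 * (n * (C * \<rho> ^ K)) \<le> 10 * (n * (C * (1 / n ^ 4)))"
    using r C n by (intro mult_left_mono) auto
  also have "\<dots> = (10 * C * D) / (n ^ 3 * D)"
    using n D by (simp add: power_numeral_reduce)
  also have "\<dots> \<le> n / (n ^ 3 * D)" using n D by (intro divide_right_mono) auto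
  also have "\<dots> = 1 / (n * n * D)" using n D by (simp add: power_numeral_reduce)
  finally show ?thesis .
qed

theorem corollary1p6:
  fixes d :: nat and lam :: real
    and N :: "nat set"
    and G :: "nat \<Rightarrow> 'a pair_pre_digraph"
    and w0 :: "nat \<Rightarrow> 'a"
  assumes "d \<ge> 3" and "lam < real d"
    and "infinite N" and "\<forall>n\<in>N. n > 0"
    and "\<forall>n\<in>N. ndl_graph n d lam (G n)"
    and "\<forall>n\<in>N. ereal_of_enat (girth (G n)) > ereal (10 * log (real d - 1) (ln (real n)))"
    and "\<forall>n\<in>N. w0 n \<in> pverts (G n)"
  shows "\<exists>\<epsilon> :: nat \<Rightarrow> real.
    (\<epsilon> \<longlongrightarrow> 0) (inf sequentially (principal N)) \<and>
    ((\<lambda>n. measure_pmf.prob (nb_walk (G n) (w0 n) n)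
        {ws. \<exists>\<eta> :: real. \<bar>\<eta>\<bar> \<le> \<epsilon> n \<and>
           real (max_visits (G n) n ws) =
             (1 + (1 + \<eta>) * (ln (ln (ln (real n))) / ln (ln (real n))))
               * (ln (real n) / ln (ln (real n)))})
      \<longlongrightarrow> 1) (inf sequentially (principal N))"
proof -
  let ?F = "inf sequentially (principal N)"
  \<comment> \<open>It must vanish while \<open>\<epsilon> x * ln (ln (ln x))\<close> diverges: then
    \<open>a ln a\<close> exceeds \<open>ln x\<close> by more than any constant multiple of
    \<open>a\<close>, and symmetrically for \<open>b\<close>.\<close>
  define \<epsilon> :: "real \<Rightarrow> real" where "\<epsilon> x = 1 / sqrt (ln (ln (ln x)))" for x
  define P where "P n = measure_pmf.prob (nb_walk (G n) (w0 n) n)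
    {ws. \<exists>\<eta>. \<bar>\<eta>\<bar> \<le> \<epsilon> (real n) \<and> real (max_visits (G n) n ws) = visits_scale \<eta> (real n)}" for n
  obtain C \<rho> where C: "C \<ge> 1" and \<rho>: "3 / 4 \<le> \<rho>" "\<rho> < 1"
    and decay: "\<And>x k. \<bar>x\<bar> \<le> lam \<Longrightarrow> \<bar>nb_poly (real d) x k\<bar> \<le> C * \<rho> ^ k"
    using nb_poly_decay[of "real d" lam] assms(1,2) by auto
  define m where "m = real d - 1"
  have m: "m \<ge> 2" using assms(1) by (simp add: m_def)
  define c where "c = 4 / (- ln \<rho>)"
  have c: "c > 0" using \<rho> by (simp add: c_def divide_pos_neg)
  define a where "a x = visits_scale (\<epsilon> x) x" for x
  define b where "b x = visits_scale (- \<epsilon> x) x" for x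
  \<comment> \<open>The three errors of \<open>max_visits_concentration\<close>, with
    \<open>K\<close> and \<open>T\<close> replaced by real bounds that account for rounding
    up.\<close>
  define u where "u x = 1 / (2 * (c * ln x)) +
      2 * (c * ln x + 1) * (b x + 1) * (8 * (b x + 1)) powr (b x + 1) / x +
      x * ((2 + 2 * a x * (c * ln x + 1)) * exp (8 * a x) * a x powr (1 - a x))" for x
  have u: "(u \<longlongrightarrow> 0) at_top"
  proof -
    have "((\<lambda>x. 1 / (2 * (c * ln x))) \<longlongrightarrow> 0) at_top"
      using c by real_asymp
    moreover have "((\<lambda>x. 2 * (c * ln x + 1) * (b x + 1) * (8 * (b x + 1)) powr (b x + 1) / x) \<longlongrightarrow> 0) at_top"
      using c unfolding b_def visits_scale_def \<epsilon>_def by real_asymp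
    moreover have "((\<lambda>x. x * ((2 + 2 * a x * (c * ln x + 1)) * exp (8 * a x) * a x powr (1 - a x))) \<longlongrightarrow> 0) at_top"
      using c unfolding a_def visits_scale_def \<epsilon>_def by real_asymp
    ultimately have "(u \<longlongrightarrow> 0 + 0 + 0) at_top"
      unfolding u_def by (intro tendsto_add)
    then show ?thesis by simp
  qed
  define good where "good x \<longleftrightarrow> ln x > 0 \<and> ln (ln x) > 0 \<and> ln (ln (ln x)) > 0 \<and> a x \<ge> 1 \<and> b x > 0 \<and>
      a x * ((c * ln x + 1) * m / ln x ^ 5) \<le> 1 / 4 \<and> (b x + 1) * (2 * (c * ln x + 1)) \<le> x - 1 \<and>
      x \<ge> 10 * C * real d \<and> x \<ge> 2" for x
  have "eventually (\<lambda>x. ln (ln (ln x)) > (0::real)) at_top"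
      "eventually (\<lambda>x. ln (ln x) > (0::real)) at_top" "eventually (\<lambda>x. ln x > (0::real)) at_top"
    by real_asymp+
  moreover have "eventually (\<lambda>x. a x \<ge> 1) at_top" "eventually (\<lambda>x. b x > 0) at_top"
    unfolding a_def b_def visits_scale_def \<epsilon>_def by real_asymp+
  moreover have "((\<lambda>x. a x * ((c * ln x + 1) * m / ln x ^ 5)) \<longlongrightarrow> 0) at_top"
    using c m unfolding a_def visits_scale_def \<epsilon>_def by real_asymp
  then have "eventually (\<lambda>x. a x * ((c * ln x + 1) * m / ln x ^ 5) < 1 / 4) at_top"
    by (rule order_tendstoD) simp
  moreover have "eventually (\<lambda>x. (b x + 1) * (2 * (c * ln x + 1)) \<le> x - 1) at_top"
    using c unfolding b_def visits_scale_def \<epsilon>_def by real_asymp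
  moreover note eventually_ge_at_top[of "10 * C * real d"] eventually_ge_at_top[of "2::real"]
  ultimately have good: "eventually good at_top"
    unfolding good_def by eventually_elim auto
  have bound: "1 - u (real n) \<le> P n" if n: "n \<in> N" and g: "good (real n)" for n
  proof -
    define x where "x = real n"
    have gx: "ln x > 0" "ln (ln x) > 0" "ln (ln (ln x)) > 0" "a x \<ge> 1" "b x > 0"
      "a x * ((c * ln x + 1) * m / ln x ^ 5) \<le> 1 / 4" "(b x + 1) * (2 * (c * ln x + 1)) \<le> x - 1"
      "x \<ge> 10 * C * real d" "x \<ge> 2"
      using g unfolding good_def x_def by auto
    have n2: "n \<ge> 2" using gx(9) by (simp add: x_def)
    have ndl: "ndl_graph n d lam (G n)" and cV: "card (pverts (G n)) = n" using assms(5) n by (auto simp: ndl_graph_def)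
    interpret nb_graph "G n" d
      using ndl assms(1) by (auto simp: nb_graph_def nb_graph_axioms_def ndl_graph_def)
    have fresh: "\<bar>fresh k u v - 1 / real n\<bar> \<le> real n * (C * \<rho> ^ k)" if "u \<in> V" "v \<in> V" for k u v
      by (rule fresh_mixing[OF ndl n2 assms(2) decay that])
    have hit: "\<bar>hit k e v - 1 / real n\<bar> \<le> 5 * (real n * (C * \<rho> ^ k))" if "e \<in> E" "v \<in> V" for e v k
      using n2 by (intro hit_mixing[OF fresh C \<rho>(1) _ that(2,1)]) auto
    have dart: "\<bar>dart k e f - 1 / (real n * real d)\<bar> \<le> 10 * (real n * (C * \<rho> ^ k))" if "e \<in> E" "f \<in> E" for e f k
      using n2 by (intro dart_mixing[OF hit[OF that(1)] C \<rho>(1) _ that]) auto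
    define K where "K = nat \<lceil>c * ln x\<rceil>"
    have cx: "c * ln x > 0" using c gx by simp
    then have K: "c * ln x \<le> real K" "real K \<le> c * ln x + 1" "K > 0" unfolding K_def by linarith+
    define T where "T = nat \<lceil>b x\<rceil>"
    have T: "real T \<le> b x + 1" "T \<ge> 1" using gx(5) unfolding T_def by linarith+
    \<comment> \<open>Half the girth bound. Rounding down costs at most a factor \<open>m\<close> in
      \<open>m ^ r\<close>, the extra \<open>m\<close> in \<open>good\<close>.\<close>
    define r where "r = nat \<lfloor>5 * log m (ln x)\<rfloor>"
    have mix: "10 * (real n * (C * \<rho> ^ K)) \<le> 1 / (real n * real n * real d)"
      using \<rho> C K(1) gx assms(1) by (intro mixing_time_bound[where c = c]) (auto simp: c_def x_def)
    have girth: "enat (2 * r) < girth (G n)"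
    proof -
      have lt: "ereal (10 * log m (ln x)) < ereal_of_enat (girth (G n))"
        using assms(6) n by (simp add: m_def x_def)
      have "log m (ln x) \<ge> 0" using gx(2) m by (simp add: log_def)
      then have "ereal (real (2 * r)) \<le> ereal (10 * log m (ln x))"
        unfolding r_def by simp
      then have "ereal_of_enat (enat (2 * r)) < ereal_of_enat (girth (G n))"
        unfolding ereal_of_enat_simps using lt by (rule le_less_trans)
      then show ?thesis by (simp only: ereal_of_enat_less_iff)
    qed
    have early: "a x * (real K / (real d - 1) ^ r) \<le> 1 / 4"
    proof -
      have "m powr (5 * log m (ln x)) = (m powr log m (ln x)) powr 5"
        by (simp add: powr_powr mult.commute)
      also have "\<dots> = ln x ^ 5" using m gx(1) by simp
      finally have "ln x ^ 5 / m = m powr (5 * log m (ln x) - 1)"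
        using m by (simp add: powr_diff)
      also have "\<dots> \<le> m powr real r"
        using m unfolding r_def by (intro powr_mono) linarith+
      also have "\<dots> = m ^ r" using m by (simp add: powr_realpow)
      finally have "real K / m ^ r \<le> (c * ln x + 1) / (ln x ^ 5 / m)"
        using K(2) cx m gx(1) by (intro frac_le) auto
      then have "a x * (real K / m ^ r) \<le> a x * ((c * ln x + 1) * m / ln x ^ 5)"
        using gx(4) by (intro mult_left_mono) auto
      from order_trans[OF this gx(6)] show ?thesis by (simp only: m_def)
    qed
    have T2: "T * (2 * K) \<le> n - 1"
    proof -
      have "real (T * (2 * K)) \<le> (b x + 1) * (2 * (c * ln x + 1))"
        using T K cx by (simp only: of_nat_mult of_nat_numeral) (intro mult_mono, auto)
      also have "\<dots> \<le> real (n - 1)" using gx(7) n2 by (simp add: x_def of_nat_diff)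
      finally show ?thesis by (simp only: of_nat_le_iff)
    qed
    have "1 - u x \<le> 1 - 1 / (2 * real K) - 2 * real K * real T * (8 * real T) ^ T / real n
      - real n * ((2 + 2 * a x * real K) * exp (8 * a x) * a x powr (1 - a x))"
    proof -
      have "1 / (2 * real K) \<le> 1 / (2 * (c * ln x))" using K cx by (intro divide_left_mono) auto
      moreover have "2 * real K * real T * (8 * real T) ^ T / real n \<le>
          2 * (c * ln x + 1) * (b x + 1) * (8 * (b x + 1)) powr (b x + 1) / x"
      proof -
        have "(8 * real T) ^ T = (8 * real T) powr real T" using T by (simp add: powr_realpow)
        also have "\<dots> \<le> (8 * real T) powr (b x + 1)" using T by (intro powr_mono) auto
        also have "\<dots> \<le> (8 * (b x + 1)) powr (b x + 1)" using T gx(5) by (intro powr_mono2) auto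
        finally show ?thesis unfolding x_def[symmetric]
          using K T gx cx by (intro divide_right_mono mult_mono) auto
      qed
      moreover have "real n * ((2 + 2 * a x * real K) * exp (8 * a x) * a x powr (1 - a x)) \<le>
          x * ((2 + 2 * a x * (c * ln x + 1)) * exp (8 * a x) * a x powr (1 - a x))"
        unfolding x_def[symmetric] using K gx(4,9)
        by (intro mult_left_mono mult_right_mono add_left_mono) auto
      ultimately show ?thesis unfolding u_def by linarith
    qed
    also have "\<dots> \<le> measure_pmf.prob (nb_walk (G n) (w0 n) n)
        {ws. b x \<le> real (max_visits (G n) n ws) \<and> real (max_visits (G n) n ws) \<le> a x}"
      using assms(7) n C \<rho> by (intro max_visits_concentration[OF _ cV n2 hit dart _ _ _ mix girth gx(4) early K(3) gx(5) T_def T2]) auto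
    also have "\<dots> \<le> P n"
      unfolding P_def a_def b_def x_def[symmetric]
      using visits_scale_between[OF gx(1-3)] by (intro measure_pmf.finite_measure_mono) auto
    finally show ?thesis by (simp add: x_def)
  qed
  have real_top: "filterlim real at_top ?F"
    by (rule filterlim_mono[OF filterlim_real_sequentially order_refl inf_le1])
  have "((\<lambda>n. 1 - u (real n)) \<longlongrightarrow> 1 - 0) ?F"
    by (intro tendsto_diff tendsto_const filterlim_compose[OF u real_top])
  moreover have "eventually (\<lambda>n. 1 - u (real n) \<le> P n) ?F"
  proof -
    have "eventually (\<lambda>n. good (real n)) ?F" using good real_top by (rule eventually_compose_filterlim)
    moreover have "eventually (\<lambda>n. n \<in> N) ?F" by (simp add: eventually_inf_principal)
    ultimately show ?thesis by eventually_elim (rule bound)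
  qed
  ultimately have "(P \<longlongrightarrow> 1) ?F"
    by (intro tendsto_sandwich[of "\<lambda>n. 1 - u (real n)" P ?F "\<lambda>_. 1"]) (auto simp: P_def)
  moreover have "((\<lambda>n. \<epsilon> (real n)) \<longlongrightarrow> 0) ?F"
  proof (rule filterlim_compose[OF _ real_top])
    show "(\<epsilon> \<longlongrightarrow> 0) at_top" unfolding \<epsilon>_def by real_asymp
  qed
  ultimately show ?thesis
    unfolding P_def visits_scale_def by (intro exI[of _ "\<lambda>n. \<epsilon> (real n)"] conjI)
qed

end
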